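(* For every $m=0,1,\ldots$, the map $\hat F_m$ has an isolated fixed point $y=\hat h_m(x_0)$ which differs from $h_m(x_0)$ (and thus also from $h(x_0)$) only by terms of $\mathcal{O}(\varepsilon^{m+1})$.
   Context: Setting. Consider the fast--slow system $x'=f(x,y,\varepsilon)$, $\varepsilon y'=g(x,y,\varepsilon)$, with $x\in\mathbf{R}^{N_s}$, $y\in\mathbf{R}^{N_f}$, $'=d/dt$, $0<\varepsilon\ll1$ ($\varepsilon$ sufficiently small), where $f,g$ are smooth. On $\{z=(x,y): g(z,0)=0\}$ one assumes $\det (D_yg)(z,0)\neq0$. The system has an $N_s$-dimensional, slow, invariant, normally attracting manifold $\mathcal{L}=\{(x,h(x)): x\in K\}$, $K\subset\mathbf{R}^{N_s}$, where $h$ satisfies $g(x,h(x),\varepsilon)-\varepsilon Dh(x)f(x,h(x),\varepsilon)=0$ and $h=\sum_{i\ge0}\varepsilon^ih_{[i]}$; in particular $g(x,h_{[0]}(x),0)=0$. Normal attractivity means that all eigenvalues of $(D_yg)(x,h_{[0]}(x),0)$ have negative real parts, bounded away from zero uniformly for $x\in K$. Fix $x_0\in K$. The point $h_m(x_0)$ is the isolated solution $y$ of $\left(\frac{d^{m+1}y}{dt^{m+1}}\right)(x_0,y)=0$ (time derivative of the $y$-component along solutions of the system, evaluated at $(x_0,y)$) satisfying $h_m(x_0)=h(x_0)+\mathcal{O}(\varepsilon^{m+1})$. Let $\phi(z;t)$ be the exact flow of the system with initial condition $z$, and $\phi^y$ its $y$-component. Let $H,\hat H>0$ be $\mathcal{O}(\varepsilon)$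 quantities (with $H/\varepsilon$, $\hat H/\varepsilon$ of order one) and $\eta=H/\hat H>0$, an $\mathcal{O}(1)$ parameter. The forward difference is $$(\Delta^{m+1}y)(z)=\sum_{\ell=0}^{m+1}(-1)^{m+1-\ell}\binom{m+1}{\ell}\phi^y(z;\ell\hat H),$$ and the map $\hat F_m:\mathbf{R}^{N_f}\to\mathbf{R}^{N_f}$ is $$\hat F_m(y)=y-(-\eta)^{m+1}(\Delta^{m+1}y)(x_0,y).$$ *)

theory Defs
  imports "HOL-Analysis.Analysis" "HOL-Library.Landau_Symbols"
begin

text \<open>
  Differentiability of order \<open>k\<close> on an open set, phrased through iterated directional
  derivatives; for functions on a Euclidean space this is the usual class of \<open>k\<close> times
  continuously differentiable functions.
\<close>

primrec Ck_on ::
  "nat \<Rightarrow> ('a::real_normed_vector \<Rightarrow> 'b::real_normed_vector) \<Rightarrow> 'a set \<Rightarrow> bool" where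
  "Ck_on 0 f S \<longleftrightarrow> continuous_on S f"
| "Ck_on (Suc k) f S \<longleftrightarrow>
     (\<forall>x\<in>S. f differentiable (at x)) \<and>
     (\<forall>v. Ck_on k (\<lambda>x. frechet_derivative f (at x) v) S)"

definition smooth_on ::
  "'a set \<Rightarrow> ('a::real_normed_vector \<Rightarrow> 'b::real_normed_vector) \<Rightarrow> bool" where
  "smooth_on S f \<longleftrightarrow> open S \<and> (\<forall>k. Ck_on k f S)"

definition complex_eigenvalue :: "real^'n^'n \<Rightarrow> complex \<Rightarrow> bool" where
  "complex_eigenvalue A l \<longleftrightarrow>
     (\<exists>v::complex^'n. v \<noteq> 0 \<and> map_matrix complex_of_real A *v v = l *s v)"

definition fast_jacobian ::
  "('a \<Rightarrow> real^'n \<Rightarrow> real \<Rightarrow> real^'n) \<Rightarrow> 'a \<Rightarrow> real^'n \<Rightarrow> real^'n^'n" where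
  "fast_jacobian g x y = jacobian (\<lambda>y'. g x y' 0) (at y)"

text \<open>The system \<open>x' = f(x,y,\<epsilon>)\<close>, \<open>\<epsilon> y' = g(x,y,\<epsilon>)\<close> as a vector field.\<close>

definition fast_slow_field ::
  "('a \<Rightarrow> 'b \<Rightarrow> real \<Rightarrow> 'a) \<Rightarrow> ('a \<Rightarrow> 'b \<Rightarrow> real \<Rightarrow> 'b) \<Rightarrow> real
     \<Rightarrow> 'a \<times> 'b \<Rightarrow> 'a \<times> ('b::real_vector)" where
  "fast_slow_field f g \<epsilon> = (\<lambda>(x, y). (f x y \<epsilon>, (1 / \<epsilon>) *\<^sub>R g x y \<epsilon>))"

definition solves_ivp ::
  "('z \<Rightarrow> 'z) \<Rightarrow> 'z::real_normed_vector \<Rightarrow> real \<Rightarrow> (real \<Rightarrow> 'z) \<Rightarrow> bool" where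
  "solves_ivp F z T Z \<longleftrightarrow>
     Z 0 = z \<and> (\<forall>t\<in>{0..T}. (Z has_vector_derivative F (Z t)) (at t within {0..T}))"

definition flow_defined :: "('z \<Rightarrow> 'z) \<Rightarrow> 'z::real_normed_vector \<Rightarrow> real \<Rightarrow> bool" where
  "flow_defined F z T \<longleftrightarrow> 0 \<le> T \<and> (\<exists>Z. solves_ivp F z T Z)"

text \<open>
  Solutions may blow up in finite time. The total function \<open>\<phi>\<close> represents the exact (forward)
  flow if it agrees with every solution as long as that solution exists; its values beyond
  the maximal interval of existence are unconstrained.
\<close>

definition is_flow :: "('z \<Rightarrow> 'z) \<Rightarrow> ('z::real_normed_vector \<Rightarrow> real \<Rightarrow> 'z) \<Rightarrow> bool" where
  "is_flow F \<phi> \<longleftrightarrow> (\<forall>z T Z. 0 \<le> T \<and> solves_ivp F z T Z \<longrightarrow> (\<forall>t\<in>{0..T}. \<phi> z t = Z t))"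

text \<open>
  The \<open>k\<close>-th time derivative of the \<open>y\<close>-component along the solution through \<open>z\<close>, taken at \<open>z\<close>,
  that is at time 0. Derivatives are one-sided at time 0 because \<open>\<phi>\<close> is a forward flow.
\<close>

definition y_time_deriv ::
  "('a \<times> 'b \<Rightarrow> real \<Rightarrow> 'a \<times> ('b::real_normed_vector)) \<Rightarrow> nat \<Rightarrow> 'a \<times> 'b \<Rightarrow> 'b" where
  "y_time_deriv \<phi> k z =
     ((\<lambda>u t. vector_derivative u (at t within {0..})) ^^ k) (\<lambda>t. snd (\<phi> z t)) 0"

definition forward_diff ::
  "('a \<times> 'b \<Rightarrow> real \<Rightarrow> 'a \<times> ('b::real_vector)) \<Rightarrow> real \<Rightarrow> nat \<Rightarrow> 'a \<times> 'b \<Rightarrow> 'b" where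
  "forward_diff \<phi> \<tau> n z =
     (\<Sum>l\<le>n. ((-1) ^ (n - l) * real (n choose l)) *\<^sub>R snd (\<phi> z (real l * \<tau>)))"

definition Fhat ::
  "('a \<times> 'b \<Rightarrow> real \<Rightarrow> 'a \<times> ('b::real_vector)) \<Rightarrow> real \<Rightarrow> real \<Rightarrow> nat \<Rightarrow> 'a \<Rightarrow> 'b \<Rightarrow> 'b" where
  "Fhat \<phi> \<eta> \<tau> m x0 y = y - ((- \<eta>) ^ (m + 1)) *\<^sub>R forward_diff \<phi> \<tau> (m + 1) (x0, y)"

end

theory Submission
  imports Defs "HOL-Computational_Algebra.Fundamental_Theorem_Algebra"
begin

text \<open>
  A fixed point of \<open>Fhat\<close> is a zero of the forward difference \<open>D\<^sub>\<epsilon>(y)\<close> of order \<open>m + 1\<close>, because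
  \<open>\<eta> \<noteq> 0\<close>. Such a zero is found by a simplified Newton iteration started at \<open>h \<epsilon> x0\<close>. It needs two
  facts: the starting point is almost a zero, and \<open>D\<^sub>\<epsilon>\<close> is uniformly close to an invertible
  linear map (\<open>unique_zero_near_linear\<close>).
  
  \<^bold>\<open>The residual is small\<close> (\<open>slow_manifold_forward_diff\<close>). The orbit through \<open>(x0, h \<epsilon> x0)\<close>
  stays on the slow manifold for a time independent of \<open>\<epsilon>\<close>, so its fast component is \<open>h \<epsilon> (X t)\<close> with \<open>X' = f X (h \<epsilon> X) \<epsilon>\<close>. A
  forward difference of order \<open>m + 1\<close> kills polynomials of degree at most \<open>m\<close>, so it suffices that
  \<open>h \<epsilon> (X t)\<close> is such a polynomial up to \<open>O(\<epsilon>\<^sup>m\<^sup>+\<^sup>1)\<close> for \<open>t = O(\<epsilon>)\<close>. The \<open>x\<close>-derivatives of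
  \<open>h \<epsilon>\<close> are not known to be bounded uniformly in \<open>\<epsilon>\<close>, so Taylor's theorem cannot be applied to
  \<open>h \<epsilon> (X t)\<close> itself. Instead \<open>h \<epsilon>\<close> is replaced by its truncated expansion \<open>p\<close>, which is smooth in
  \<open>(x, \<epsilon>)\<close> up to \<open>\<epsilon> = 0\<close>. Along \<open>X\<close> the time derivative of a smooth function \<open>q\<close> differs only by
  \<open>O(\<epsilon>\<^sup>m\<^sup>+\<^sup>1)\<close> from the derivative of \<open>q\<close> along the field \<open>V(x, \<epsilon>) = f x (p (x, \<epsilon>)) \<epsilon>\<close>, and
  repeated integration gives a Taylor expansion with that error (\<open>approximate_flow_expansion\<close>).
  
  \<^bold>\<open>The linearization is invertible\<close> (\<open>fast_forward_diff_near_linear\<close>). In the fast time \<open>t / \<epsilon>\<close> the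
  field is \<open>(\<epsilon> f, g)\<close>. Near \<open>(x0, hc 0 x0)\<close> and for small \<open>\<epsilon>\<close> it differs from its linearization
  \<open>B (x, y) = (0, D\<^sub>x g x + D\<^sub>y g y)\<close> by a map with small Lipschitz constant, so the flow depends on
  \<open>y\<close> like the linear flow \<open>S t\<close> of \<open>A = D\<^sub>y g\<close>. With \<open>s = Hh \<epsilon> / \<epsilon>\<close> the linear part of \<open>D\<^sub>\<epsilon>\<close> is
  therefore close to the forward difference of \<open>S (l s) = (S s)\<^sup>l\<close>, which is \<open>(S s - 1)\<^sup>m\<^sup>+\<^sup>1\<close>. A
  nonzero fixed vector of \<open>S s\<close> would lie on a periodic orbit of the linear equation, which would give
  \<open>A\<close> an eigenvalue on the imaginary axis (\<open>hurwitz_no_periodic_orbit\<close>). Since \<open>s\<close> ranges in a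
  compact interval that avoids 0, \<open>S s - 1\<close> is bounded below uniformly.
\<close>

section \<open>Calculus of smooth maps\<close>

lemma Ck_on_cong:
  assumes "open S" "\<And>x. x \<in> S \<Longrightarrow> f x = g x" "Ck_on k f S"
  shows "Ck_on k g S"
  using assms(2,3)
proof (induction k arbitrary: f g)
  case 0
  have "continuous_on S f = continuous_on S g" by (rule continuous_on_cong) (simp_all add: 0)
  then show ?case using 0 by simp
next
  case (Suc k)
  have d: "(g has_derivative frechet_derivative f (at x)) (at x)" if "x \<in> S" for x
  proof (rule has_derivative_transform_within_open[OF _ assms(1) that])
    show "(f has_derivative frechet_derivative f (at x)) (at x)"
      using Suc.prems(2) that by (simp add: frechet_derivative_works[symmetric])
  qed (rule Suc.prems(1))
  have e: "frechet_derivative f (at x) = frechet_derivative g (at x)" if "x \<in> S" for x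
    using d[OF that] by (rule frechet_derivative_at)
  have "Ck_on k (\<lambda>x. frechet_derivative g (at x) v) S" for v
  proof (rule Suc.IH)
    show "Ck_on k (\<lambda>x. frechet_derivative f (at x) v) S" using Suc.prems(2) by simp
    show "frechet_derivative f (at x) v = frechet_derivative g (at x) v" if "x \<in> S" for x
      using e[OF that] by (rule fun_cong)
  qed
  moreover have "g differentiable at x" if "x \<in> S" for x
    using d[OF that] by (rule differentiableI)
  ultimately show ?case by simp
qed

text \<open>
  The derivative is unique on an open set, so any formula for it may be used in place of
  \<open>frechet_derivative\<close>.
\<close>

lemma Ck_on_SucI:
  assumes "open S" "\<And>x. x \<in> S \<Longrightarrow> (f has_derivative f' x) (at x)"
    "\<And>v. Ck_on k (\<lambda>x. f' x v) S"
  shows "Ck_on (Suc k) f S"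
proof -
  have "Ck_on k (\<lambda>x. frechet_derivative f (at x) v) S" for v
    by (rule Ck_on_cong[OF assms(1) _ assms(3)[of v]]) (rule fun_cong[OF frechet_derivative_at[OF assms(2)]])
  moreover have "f differentiable at x" if "x \<in> S" for x
    using assms(2)[OF that] by (rule differentiableI)
  ultimately show ?thesis by simp
qed

lemma Ck_on_SucD:
  assumes "Ck_on (Suc k) f S"
  shows "x \<in> S \<Longrightarrow> (f has_derivative frechet_derivative f (at x)) (at x)"
    and "Ck_on k (\<lambda>x. frechet_derivative f (at x) v) S"
  using assms by (auto simp: frechet_derivative_works[symmetric])

lemma Ck_on_Suc_imp: "Ck_on (Suc k) f S \<Longrightarrow> Ck_on k f S"
proof (induction k arbitrary: f)
  case 0
  then show ?case
    by (simp add: continuous_at_imp_continuous_on differentiable_imp_continuous_within)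
next
  case (Suc k)
  then show ?case unfolding Ck_on.simps(2)[of "Suc k"] Ck_on.simps(2)[of k] by simp
qed

lemma Ck_on_imp_continuous_on: "Ck_on k f S \<Longrightarrow> continuous_on S f"
proof (induction k)
  case (Suc k)
  then show ?case using Ck_on_Suc_imp by blast
qed simp

lemma Ck_on_const: "open S \<Longrightarrow> Ck_on k (\<lambda>x. c) S"
proof (induction k arbitrary: c)
  case (Suc k)
  show ?case by (rule Ck_on_SucI[OF Suc.prems has_derivative_const Suc.IH[OF Suc.prems]])
qed simp

lemma Ck_on_linear: "open S \<Longrightarrow> bounded_linear f \<Longrightarrow> Ck_on k f S"
proof (cases k)
  case (Suc j)
  assume S: "open S" "bounded_linear f"
  show ?thesis unfolding Suc
    by (rule Ck_on_SucI[OF S(1) bounded_linear_imp_has_derivative[OF S(2)] Ck_on_const[OF S(1)]])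
qed (simp add: linear_continuous_on)

lemma Ck_on_add:
  "open S \<Longrightarrow> Ck_on k f S \<Longrightarrow> Ck_on k g S \<Longrightarrow> Ck_on k (\<lambda>x. f x + g x) S"
proof (induction k arbitrary: f g)
  case (Suc k)
  note p = Suc.prems(1)
  note f = Ck_on_SucD[OF Suc.prems(2)] and g = Ck_on_SucD[OF Suc.prems(3)]
  show ?case
    by (rule Ck_on_SucI[OF p has_derivative_add[OF f(1) g(1)] Suc.IH[OF p f(2) g(2)]])
qed (simp add: continuous_on_add)

lemma Ck_on_sum:
  assumes "open S" "\<And>i. i \<in> I \<Longrightarrow> Ck_on k (f i) S"
  shows "Ck_on k (\<lambda>x. \<Sum>i\<in>I. f i x) S"
  using assms(2) by (induction I rule: infinite_finite_induct) (simp_all add: Ck_on_const Ck_on_add assms(1))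

lemma Ck_on_scaleR:
  fixes f :: "'a::real_normed_vector \<Rightarrow> real"
  shows "open S \<Longrightarrow> Ck_on k f S \<Longrightarrow> Ck_on k g S \<Longrightarrow> Ck_on k (\<lambda>x. f x *\<^sub>R g x) S"
proof (induction k arbitrary: f g)
  case (Suc k)
  note p = Suc.prems(1)
  note f = Ck_on_SucD[OF Suc.prems(2)] and g = Ck_on_SucD[OF Suc.prems(3)]
  show ?case
    by (rule Ck_on_SucI[OF p has_derivative_scaleR[OF f(1) g(1)]
          Ck_on_add[OF p Suc.IH[OF p Ck_on_Suc_imp[OF Suc.prems(2)] g(2)]
            Suc.IH[OF p f(2) Ck_on_Suc_imp[OF Suc.prems(3)]]]])
qed (simp add: continuous_on_scaleR)

lemma Ck_on_Pair:
  "open S \<Longrightarrow> Ck_on k f S \<Longrightarrow> Ck_on k g S \<Longrightarrow> Ck_on k (\<lambda>x. (f x, g x)) S"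
proof (induction k arbitrary: f g)
  case (Suc k)
  note p = Suc.prems(1)
  note f = Ck_on_SucD[OF Suc.prems(2)] and g = Ck_on_SucD[OF Suc.prems(3)]
  show ?case
    by (rule Ck_on_SucI[OF p has_derivative_Pair[OF f(1) g(1)] Suc.IH[OF p f(2) g(2)]])
qed (simp add: continuous_on_Pair)

lemma linear_basis_expand:
  fixes f :: "'a::euclidean_space \<Rightarrow> 'b::real_vector"
  assumes "linear f" shows "f x = (\<Sum>b\<in>Basis. (x \<bullet> b) *\<^sub>R f b)"
proof -
  have "f x = f (\<Sum>b\<in>Basis. (x \<bullet> b) *\<^sub>R b)" by (simp add: euclidean_representation)
  also have "\<dots> = (\<Sum>b\<in>Basis. (x \<bullet> b) *\<^sub>R f b)"
    by (simp add: linear_sum[OF assms] linear_cmul[OF assms])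
  finally show ?thesis .
qed

lemma Ck_on_inner_const:
  fixes f :: "'a::real_normed_vector \<Rightarrow> 'b::real_inner"
  shows "open S \<Longrightarrow> Ck_on k f S \<Longrightarrow> Ck_on k (\<lambda>x. f x \<bullet> c) S"
proof (induction k arbitrary: f)
  case (Suc k)
  note p = Suc.prems(1)
  note f = Ck_on_SucD[OF Suc.prems(2)]
  show ?case
    by (rule Ck_on_SucI[OF p has_derivative_inner_left[OF f(1)] Suc.IH[OF p f(2)]])
qed (simp add: continuous_on_inner)

text \<open>
  The chain rule is written as a finite sum over a basis, because order \<open>k\<close> differentiability
  speaks of directional derivatives in constant directions only.
\<close>

lemma Ck_on_compose:
  fixes f :: "'a::real_normed_vector \<Rightarrow> 'b::euclidean_space"
  assumes "open S" "open T" "f ` S \<subseteq> T"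
  shows "Ck_on k f S \<Longrightarrow> Ck_on k g T \<Longrightarrow> Ck_on k (\<lambda>x. g (f x)) S"
proof (induction k arbitrary: g)
  case 0
  then show ?case using continuous_on_compose2[of T g S f] assms(3) by simp
next
  case (Suc k)
  let ?f' = "\<lambda>x. frechet_derivative f (at x)" and ?g' = "\<lambda>y. frechet_derivative g (at y)"
  show ?case
  proof (rule Ck_on_SucI[OF assms(1), where f'="\<lambda>x v. \<Sum>b\<in>Basis. (?f' x v \<bullet> b) *\<^sub>R ?g' (f x) b"])
    fix x assume "x \<in> S"
    then have g: "(g has_derivative ?g' (f x)) (at (f x))"
      using Ck_on_SucD(1)[OF Suc.prems(2), of "f x"] assms(3) by auto
    have "((\<lambda>x. g (f x)) has_derivative (\<lambda>v. ?g' (f x) (?f' x v))) (at x)"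
      using has_derivative_compose[OF Ck_on_SucD(1)[OF Suc.prems(1) \<open>x \<in> S\<close>] g] .
    moreover have "(\<lambda>v. ?g' (f x) (?f' x v)) =
        (\<lambda>v. \<Sum>b\<in>Basis. (?f' x v \<bullet> b) *\<^sub>R ?g' (f x) b)"
      by (rule ext, rule linear_basis_expand[OF has_derivative_linear[OF g]])
    ultimately show "((\<lambda>x. g (f x)) has_derivative
        (\<lambda>v. \<Sum>b\<in>Basis. (?f' x v \<bullet> b) *\<^sub>R ?g' (f x) b)) (at x)"
      by simp
  next
    fix v
    show "Ck_on k (\<lambda>x. \<Sum>b\<in>Basis. (?f' x v \<bullet> b) *\<^sub>R ?g' (f x) b) S"
      by (intro Ck_on_sum Ck_on_scaleR Ck_on_inner_const Suc.IH Ck_on_Suc_imp[OF Suc.prems(1)]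
          Ck_on_SucD(2)[OF Suc.prems(1)] Ck_on_SucD(2)[OF Suc.prems(2)] assms)
  qed
qed

lemma smooth_onD:
  assumes "smooth_on S f"
  shows "open S" "continuous_on S f"
    and "x \<in> S \<Longrightarrow> (f has_derivative frechet_derivative f (at x)) (at x)"
    and "smooth_on S (\<lambda>x. frechet_derivative f (at x) v)"
proof -
  have o: "open S" and "\<And>k. Ck_on k f S" using assms by (auto simp: smooth_on_def)
  then show "open S" "continuous_on S f" by (auto dest: Ck_on_imp_continuous_on)
  have s: "Ck_on (Suc k) f S" for k by fact
  show "x \<in> S \<Longrightarrow> (f has_derivative frechet_derivative f (at x)) (at x)"
    "smooth_on S (\<lambda>x. frechet_derivative f (at x) v)"
    using Ck_on_SucD[OF s] o by (auto simp: smooth_on_def)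
qed

lemma smooth_on_cong:
  assumes "\<And>x. x \<in> S \<Longrightarrow> f x = g x" "smooth_on S f"
  shows "smooth_on S g"
proof -
  have "open S" "\<And>k. Ck_on k f S" using assms(2) by (auto simp: smooth_on_def)
  then have "Ck_on k g S" for k using Ck_on_cong[OF \<open>open S\<close> assms(1)] by simp
  then show ?thesis using \<open>open S\<close> by (simp add: smooth_on_def)
qed

lemma smooth_on_compose:
  fixes f :: "'a::real_normed_vector \<Rightarrow> 'b::euclidean_space"
  assumes "smooth_on T g" "smooth_on S f" "f ` S \<subseteq> T"
  shows "smooth_on S (\<lambda>x. g (f x))"
  using assms unfolding smooth_on_def by (blast intro: Ck_on_compose)

lemma smooth_on_Pair:
  "smooth_on S f \<Longrightarrow> smooth_on S g \<Longrightarrow> smooth_on S (\<lambda>x. (f x, g x))"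
  unfolding smooth_on_def by (blast intro: Ck_on_Pair)

lemma smooth_on_linear: "open S \<Longrightarrow> bounded_linear f \<Longrightarrow> smooth_on S f"
  unfolding smooth_on_def by (blast intro: Ck_on_linear)

lemma smooth_on_const: "open S \<Longrightarrow> smooth_on S (\<lambda>x. c)"
  unfolding smooth_on_def by (blast intro: Ck_on_const)

lemma smooth_on_scaleR:
  fixes f :: "'a::real_normed_vector \<Rightarrow> real"
  shows "smooth_on S f \<Longrightarrow> smooth_on S g \<Longrightarrow> smooth_on S (\<lambda>x. f x *\<^sub>R g x)"
  unfolding smooth_on_def by (blast intro: Ck_on_scaleR)

lemma smooth_on_sum:
  "open S \<Longrightarrow> (\<And>i. i \<in> I \<Longrightarrow> smooth_on S (f i)) \<Longrightarrow> smooth_on S (\<lambda>x. \<Sum>i\<in>I. f i x)"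
  unfolding smooth_on_def by (blast intro: Ck_on_sum)

text \<open>
  Closure under the Lie derivative along a smooth field, the operation that is iterated in a
  Taylor expansion along a flow.
\<close>

lemma smooth_on_directional_derivative:
  fixes q :: "'a::euclidean_space \<Rightarrow> 'b::real_normed_vector"
  assumes q: "smooth_on S q" and V: "smooth_on S V"
  shows "smooth_on S (\<lambda>z. frechet_derivative q (at z) (V z))"
proof -
  note o = smooth_onD(1)[OF q]
  have "smooth_on S (\<lambda>z. \<Sum>b\<in>Basis. (V z \<bullet> b) *\<^sub>R frechet_derivative q (at z) b)"
    using V smooth_onD(4)[OF q] unfolding smooth_on_def
    by (auto intro!: Ck_on_sum Ck_on_scaleR Ck_on_inner_const)
  moreover have "(\<Sum>b\<in>Basis. (V z \<bullet> b) *\<^sub>R frechet_derivative q (at z) b)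
      = frechet_derivative q (at z) (V z)" if "z \<in> S" for z
    by (rule linear_basis_expand[OF has_derivative_linear[OF smooth_onD(3)[OF q that]], symmetric])
  ultimately show ?thesis
    by (rule smooth_on_cong[rotated])
qed

lemma smooth_on_derivative_bound:
  fixes f :: "'a::euclidean_space \<Rightarrow> 'b::real_normed_vector"
  assumes f: "smooth_on S f" and C: "compact C" "C \<subseteq> S"
  obtains L where "L > 0" "\<And>x v. x \<in> C \<Longrightarrow> norm (frechet_derivative f (at x) v) \<le> L * norm v"
proof -
  let ?D = "\<lambda>x. frechet_derivative f (at x)"
  have "\<exists>M>0. \<forall>x\<in>C. norm (?D x b) \<le> M" for b
  proof -
    have "continuous_on C (\<lambda>x. ?D x b)"
      using smooth_onD(2)[OF smooth_onD(4)[OF f]] continuous_on_subset C by blast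
    then have "bounded ((\<lambda>x. ?D x b) ` C)"
      using C(1) compact_continuous_image compact_imp_bounded by blast
    then show ?thesis unfolding bounded_pos by auto
  qed
  then obtain M where M: "\<And>b. M b > 0" "\<And>b x. x \<in> C \<Longrightarrow> norm (?D x b) \<le> M b" by metis
  let ?L = "(\<Sum>b\<in>Basis. M b)"
  have "norm (?D x v) \<le> ?L * norm v" if "x \<in> C" for x v
  proof -
    have l: "linear (?D x)" using smooth_onD(3)[OF f] that C(2) has_derivative_linear by blast
    have "norm (?D x v) \<le> (\<Sum>b\<in>Basis. norm ((v \<bullet> b) *\<^sub>R ?D x b))"
      unfolding linear_basis_expand[OF l, of v] by (rule norm_sum)
    also have "\<dots> \<le> (\<Sum>b\<in>Basis. norm v * M b)"
      using M(2)[OF that] by (intro sum_mono) (auto intro!: mult_mono Basis_le_norm)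
    finally show ?thesis by (simp add: sum_distrib_left mult.commute)
  qed
  moreover have "?L > 0" using M(1) by (simp add: sum_pos)
  ultimately show ?thesis using that by blast
qed

lemma smooth_on_lipschitz:
  fixes f :: "'a::euclidean_space \<Rightarrow> 'b::real_normed_vector"
  assumes f: "smooth_on S f" and C: "compact C" "C \<subseteq> S" "convex C"
  obtains L where "L > 0" "\<And>x y. x \<in> C \<Longrightarrow> y \<in> C \<Longrightarrow> norm (f x - f y) \<le> L * norm (x - y)"
proof -
  obtain L where L: "L > 0" "\<And>x v. x \<in> C \<Longrightarrow> norm (frechet_derivative f (at x) v) \<le> L * norm v"
    using smooth_on_derivative_bound[OF f C(1,2)] by blast
  have "norm (f x - f y) \<le> L * norm (x - y)" if "x \<in> C" "y \<in> C" for x y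
  proof (rule differentiable_bound[OF C(3) _ _ that])
    fix z assume z: "z \<in> C"
    show "(f has_derivative frechet_derivative f (at z)) (at z within C)"
      using smooth_onD(3)[OF f] z C(2) has_derivative_at_withinI by blast
    show "onorm (frechet_derivative f (at z)) \<le> L" using L(2)[OF z] by (rule onorm_le)
  qed
  then show ?thesis using that L(1) by blast
qed

text \<open>
  Strict differentiability: the derivative is continuous, so by the mean value inequality the
  remainder of the linearization has a small Lipschitz constant near \<open>c\<close>.
\<close>

lemma smooth_on_strictly_differentiable:
  fixes f :: "'a::euclidean_space \<Rightarrow> 'b::real_normed_vector"
  assumes f: "smooth_on S f" and c: "c \<in> S" and "\<delta> > 0"
  obtains r where "r > 0" "cball c r \<subseteq> S"
    "\<And>x y. x \<in> cball c r \<Longrightarrow> y \<in> cball c r \<Longrightarrow>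
      norm (f x - f y - frechet_derivative f (at c) (x - y)) \<le> \<delta> * norm (x - y)"
proof -
  let ?D = "\<lambda>x. frechet_derivative f (at x)"
  let ?n = "real DIM('a)"
  have lin: "linear (?D x)" if "x \<in> S" for x
    using smooth_onD(3)[OF f that] has_derivative_linear by blast
  have "\<forall>\<^sub>F x in at c. norm (?D x b - ?D c b) < \<delta> / ?n" for b
  proof -
    have "continuous_on S (\<lambda>x. ?D x b)"
      using smooth_onD(2)[OF smooth_onD(4)[OF f]] .
    then have "((\<lambda>x. ?D x b) \<longlongrightarrow> ?D c b) (at c)"
      using c smooth_onD(1)[OF f] by (simp add: continuous_on_eq_continuous_at isCont_def)
    then show ?thesis unfolding tendsto_iff dist_norm using \<open>\<delta> > 0\<close> by simp
  qed
  then have "\<forall>\<^sub>F x in at c. \<forall>b\<in>Basis. norm (?D x b - ?D c b) < \<delta> / ?n"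
    by (simp add: eventually_ball_finite)
  moreover have "\<forall>\<^sub>F x in at c. x \<in> S"
    using c smooth_onD(1)[OF f] eventually_at_in_open' by blast
  ultimately have "\<forall>\<^sub>F x in at c. x \<in> S \<and> (\<forall>b\<in>Basis. norm (?D x b - ?D c b) < \<delta> / ?n)"
    by eventually_elim blast
  then obtain r where r: "r > 0"
    "\<And>x. x \<noteq> c \<Longrightarrow> dist x c < r \<Longrightarrow> x \<in> S \<and> (\<forall>b\<in>Basis. norm (?D x b - ?D c b) < \<delta> / ?n)"
    unfolding eventually_at by blast
  have *: "x \<in> S" "\<forall>b\<in>Basis. norm (?D x b - ?D c b) \<le> \<delta> / ?n" if "x \<in> cball c (r / 2)" for x
    using r(1) r(2)[of x] c \<open>\<delta> > 0\<close> that by (cases "x = c"; force simp: dist_commute)+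
  have onb: "norm (?D z v - ?D c v) \<le> \<delta> * norm v" if z: "z \<in> cball c (r / 2)" for z v
  proof -
    have "linear (\<lambda>v. ?D z v - ?D c v)" using lin *(1)[OF z] c by (intro linear_compose_sub)
    then have "norm (?D z v - ?D c v) = norm (\<Sum>b\<in>Basis. (v \<bullet> b) *\<^sub>R (?D z b - ?D c b))"
      by (subst linear_basis_expand[where f="\<lambda>v. ?D z v - ?D c v"]) auto
    also have "\<dots> \<le> (\<Sum>b\<in>Basis. norm ((v \<bullet> b) *\<^sub>R (?D z b - ?D c b)))" by (rule norm_sum)
    also have "\<dots> \<le> (\<Sum>b\<in>(Basis::'a set). norm v * (\<delta> / ?n))"
      unfolding norm_scaleR real_norm_def[symmetric]
      by (intro sum_mono mult_mono) (use *(2)[OF z] in \<open>auto simp: Basis_le_norm\<close>)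
    finally show ?thesis by (simp add: mult.commute)
  qed
  have "norm ((f x - ?D c x) - (f y - ?D c y)) \<le> \<delta> * norm (x - y)"
    if "x \<in> cball c (r / 2)" "y \<in> cball c (r / 2)" for x y
  proof (rule differentiable_bound[OF convex_cball _ _ that])
    fix z assume z: "z \<in> cball c (r / 2)"
    have bl: "bounded_linear (?D c)"
      using smooth_onD(3)[OF f c] has_derivative_bounded_linear by blast
    show "((\<lambda>x. f x - ?D c x) has_derivative (\<lambda>v. ?D z v - ?D c v)) (at z within cball c (r / 2))"
      using smooth_onD(3)[OF f *(1)[OF z]]
      by (rule has_derivative_diff[OF has_derivative_at_withinI
            bounded_linear_imp_has_derivative[OF bl]])
    show "onorm (\<lambda>v. ?D z v - ?D c v) \<le> \<delta>" using onb[OF z] by (rule onorm_le)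
  qed
  then have "norm (f x - f y - ?D c (x - y)) \<le> \<delta> * norm (x - y)"
    if "x \<in> cball c (r / 2)" "y \<in> cball c (r / 2)" for x y
    unfolding linear_diff[OF lin[OF c], of x y]
    using that by (metis (no_types, lifting) diff_diff_eq2 diff_diff_add add.commute add_diff_eq)
  with * r(1) show ?thesis by (intro that[of "r / 2"]) auto
qed

lemma smooth_on_power: 
  fixes f :: "'a::real_normed_vector \<Rightarrow> real"
  assumes "smooth_on S f" shows "smooth_on S (\<lambda>x. f x ^ i)"
proof (induction i)
  case 0
  then show ?case using smooth_on_const[OF smooth_onD(1)[OF assms]] by simp
next
  case (Suc i)
  then show ?case using smooth_on_scaleR[OF assms Suc] by simp
qed

lemma smooth_on_bounded:
  assumes "smooth_on S f" "compact C" "C \<subseteq> S"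
  obtains M where "M > 0" "\<And>x. x \<in> C \<Longrightarrow> norm (f x) \<le> M"
proof -
  have "bounded (f ` C)"
    using smooth_onD(2)[OF assms(1)] assms(2,3)
    by (intro compact_imp_bounded compact_continuous_image) (auto elim: continuous_on_subset)
  then show ?thesis unfolding bounded_pos using that by blast
qed

section \<open>Initial value problems\<close>

lemma norm_increment_le:
  fixes u :: "real \<Rightarrow> 'a::real_normed_vector"
  assumes u: "\<And>t. t \<in> {0..T} \<Longrightarrow> (u has_vector_derivative u' t) (at t within {0..T})"
    and p: "\<And>t. t \<in> {0..T} \<Longrightarrow> (p has_real_derivative p' t) (at t within {0..T})"
    and le: "\<And>t. t \<in> {0..T} \<Longrightarrow> norm (u' t) \<le> p' t"
    and t: "t \<in> {0..T}"
  shows "norm (u t - u 0) \<le> p t - p 0"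
proof (cases "t = 0")
  case False
  then have t0: "0 < t" "t \<le> T" using t by auto
  have at: "at r within {0..T} = at r" if "0 < r" "r < t" for r
    using that t0 by (intro at_within_interior) auto
  have cu: "continuous_on {0..T} u"
    using u by (rule continuous_on_vector_derivative)
  have cp: "continuous_on {0..T} p"
    using p by (intro DERIV_continuous_on)
  show ?thesis
  proof (rule differentiable_bound_general[OF t0(1), where f' = u' and \<phi>' = p'])
    show "continuous_on {0..t} u" "continuous_on {0..t} p"
      using cu cp t0 by (auto elim: continuous_on_subset)
    fix r assume r: "0 < r" "r < t"
    then have "r \<in> {0..T}" using t0 by auto
    then show "(u has_vector_derivative u' r) (at r)" "(p has_vector_derivative p' r) (at r)"
      "norm (u' r) \<le> p' r"
      using u[of r] p[of r] le[of r] at[OF r]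
      by (auto simp: has_real_derivative_iff_has_vector_derivative)
  qed
qed simp

text \<open>
  Gronwall's inequality. It gives uniqueness for linear equations and the comparison of a nearly linear
  flow with the linear one.
\<close>

lemma gronwall_affine:
  fixes u :: "real \<Rightarrow> 'a::banach"
  assumes u: "\<And>t. t \<in> {0..T} \<Longrightarrow> (u has_vector_derivative u' t) (at t within {0..T})"
    and le: "\<And>t. t \<in> {0..T} \<Longrightarrow> norm (u' t) \<le> a + L * norm (u t)"
    and "0 \<le> a" "0 \<le> L" and t: "t \<in> {0..T}"
  shows "norm (u t) \<le> (norm (u 0) + a * t) * exp (L * t)"
proof -
  define I where "I = (\<lambda>t. norm (u 0) + a * t + L * integral {0..t} (\<lambda>r. norm (u r)))"
  have cu: "continuous_on {0..T} (\<lambda>r. norm (u r))"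
    using u by (intro continuous_on_norm continuous_on_vector_derivative)
  have I': "(I has_real_derivative a + L * norm (u r)) (at r within {0..T})" if "r \<in> {0..T}" for r
    unfolding I_def using integral_has_real_derivative[OF cu that]
    by (auto intro!: derivative_eq_intros)
  have I0: "I 0 = norm (u 0)" by (simp add: I_def)
  have uI: "norm (u r) \<le> I r" if "r \<in> {0..T}" for r
  proof -
    have "norm (u r - u 0) \<le> I r - I 0" by (rule norm_increment_le[OF u I' le that])
    then show ?thesis using norm_triangle_ineq2[of "u r" "u 0"] I0 by linarith
  qed
  \<comment> \<open>the majorant \<open>I\<close> satisfies \<open>I' \<le> a + L I\<close>, so \<open>J' \<le> a\<close>\<close>
  define J where "J = (\<lambda>r. I r * exp (- L * r))"
  have J': "(J has_real_derivative (a + L * norm (u r) - L * I r) * exp (- L * r)) (at r within {0..T})"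
    if "r \<in> {0..T}" for r
    unfolding J_def by (rule derivative_eq_intros I'[OF that] refl | simp add: algebra_simps)+
  have "J t - J 0 \<le> a * t - a * 0"
  proof (cases "t = 0")
    case False
    then have t0: "0 < t" "t \<le> T" using t by auto
    have "(\<lambda>r. J r - a * r) t \<le> (\<lambda>r. J r - a * r) 0"
    proof (rule DERIV_nonpos_imp_decreasing_open[where f = "\<lambda>r. J r - a * r"])
      show "continuous_on {0..t} (\<lambda>r. J r - a * r)"
        using continuous_on_subset[OF DERIV_continuous_on[OF J'], of "{0..t}"] t0
        by (intro continuous_on_diff continuous_on_mult continuous_on_const continuous_on_id) auto
      fix r assume r: "0 < r" "r < t"
      then have rT: "r \<in> {0..T}" and at: "at r within {0..T} = at r"
        using t0 by (auto intro!: at_within_interior)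
      have "((\<lambda>r. J r - a * r) has_real_derivative
          (a + L * norm (u r) - L * I r) * exp (- L * r) - a) (at r)"
        using J'[OF rT] unfolding at by (auto intro!: derivative_eq_intros)
      moreover have "(a + L * norm (u r) - L * I r) * exp (- L * r) \<le> a"
      proof -
        have "(a + L * norm (u r) - L * I r) * exp (- L * r) \<le> a * exp (- L * r)"
          using mult_left_mono[OF uI[OF rT] \<open>0 \<le> L\<close>] by (intro mult_right_mono) auto
        also have "\<dots> \<le> a * 1"
          using r \<open>0 \<le> a\<close> \<open>0 \<le> L\<close> by (intro mult_left_mono) auto
        finally show ?thesis by simp
      qed
      ultimately show "\<exists>y. DERIV (\<lambda>r. J r - a * r) r :> y \<and> y \<le> 0"
        by (intro exI[of _ "(a + L * norm (u r) - L * I r) * exp (- L * r) - a"]) auto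
    qed (use t0 in auto)
    then show ?thesis by simp
  qed simp
  then have "I t * exp (- L * t) \<le> norm (u 0) + a * t" by (simp add: J_def I0)
  then have "I t * exp (- L * t) * exp (L * t) \<le> (norm (u 0) + a * t) * exp (L * t)"
    by (intro mult_right_mono) auto
  then have "I t \<le> (norm (u 0) + a * t) * exp (L * t)"
    by (simp add: mult.assoc exp_add[symmetric])
  then show ?thesis using uI[OF t] by linarith
qed

text \<open>
  Picard's theorem on an arbitrarily long interval in one step: with the weight \<open>exp (- 2 L t)\<close> the
  integral operator contracts by the factor 1/2, whatever the length of the interval.
\<close>

lemma lipschitz_ivp_exists:
  fixes F :: "'a::banach \<Rightarrow> 'a"
  assumes F: "\<And>x y. norm (F x - F y) \<le> L * norm (x - y)" and L: "0 < L" and T: "0 \<le> T"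
  shows "\<exists>Z. solves_ivp F z T Z"
proof -
  have contF: "continuous_on S F" for S
    using F L by (intro lipschitz_on_continuous_on[where L=L] lipschitz_onI)
      (auto simp: dist_norm)
  define c where "c = 2 * L"
  have c: "c > 0" using L by (simp add: c_def)
  \<comment> \<open>clamping the time makes the unknown a bounded continuous function on the whole line\<close>
  define cl where "cl = (\<lambda>t. max 0 (min T t))"
  have cl: "cl t \<in> {0..T}" and cl_id: "t \<in> {0..T} \<Longrightarrow> cl t = t" for t using T by (auto simp: cl_def)
  have ccl: "continuous_on UNIV cl" unfolding cl_def by (intro continuous_intros)
  \<comment> \<open>Picard operator for the rescaled unknown \<open>exp (- c t) Z(t)\<close>\<close>
  define I where "I = (\<lambda>w t. integral {0..t} (\<lambda>r. F (exp (c * r) *\<^sub>R apply_bcontfun w r)))"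
  define P where "P = (\<lambda>w t. exp (- c * cl t) *\<^sub>R (z + I w (cl t)))"
  have cont: "continuous_on {0..T} (\<lambda>r. F (exp (c * r) *\<^sub>R apply_bcontfun w r))" for w
    by (rule continuous_on_compose2[OF contF[of UNIV]]) (auto intro!: continuous_intros)
  have I': "(I w has_vector_derivative F (exp (c * t) *\<^sub>R apply_bcontfun w t)) (at t within {0..T})"
    if "t \<in> {0..T}" for w t
    unfolding I_def by (rule integral_has_vector_derivative[OF cont that])
  have I0: "I w 0 = 0" for w by (simp add: I_def)
  have contI: "continuous_on {0..T} (I w)" for w
    using I' by (rule continuous_on_vector_derivative)
  have Pb: "P w \<in> bcontfun" for w
  proof -
    let ?g = "\<lambda>t. exp (- c * t) *\<^sub>R (z + I w t)"
    have g: "continuous_on {0..T} ?g" by (intro continuous_intros contI)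
    have "continuous_on UNIV (P w)" unfolding P_def
      by (rule continuous_on_compose2[OF g ccl]) (use cl in auto)
    moreover have "bounded (?g ` {0..T})"
      by (intro compact_imp_bounded compact_continuous_image g) auto
    then have "bounded (range (P w))"
      by (rule bounded_subset) (use cl in \<open>auto simp: P_def\<close>)
    ultimately show ?thesis by (simp add: bcontfun_def)
  qed
  have dP: "dist (Bcontfun (P w)) (Bcontfun (P v)) \<le> 1 / 2 * dist w v" for w v
  proof (rule dist_bound)
    fix t
    define s where "s = cl t"
    have s: "s \<in> {0..T}" using cl by (simp add: s_def)
    let ?d = "dist w v"
    have "norm ((I w s - I v s) - (I w 0 - I v 0)) \<le> ?d / 2 * exp (c * s) - ?d / 2 * exp (c * 0)"
    proof (rule norm_increment_le[OF _ _ _ s, where u = "\<lambda>s. I w s - I v s" and p = "\<lambda>s. ?d / 2 * exp (c * s)"])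
      fix r assume r: "r \<in> {0..T}"
      show "((\<lambda>s. I w s - I v s) has_vector_derivative
          F (exp (c * r) *\<^sub>R apply_bcontfun w r) - F (exp (c * r) *\<^sub>R apply_bcontfun v r)) (at r within {0..T})"
        by (intro has_vector_derivative_diff I' r)
      show "((\<lambda>s. ?d / 2 * exp (c * s)) has_real_derivative L * ?d * exp (c * r)) (at r within {0..T})"
        by (rule derivative_eq_intros refl | simp add: c_def)+
      have "norm (F (exp (c * r) *\<^sub>R apply_bcontfun w r) - F (exp (c * r) *\<^sub>R apply_bcontfun v r))
          \<le> L * norm (exp (c * r) *\<^sub>R apply_bcontfun w r - exp (c * r) *\<^sub>R apply_bcontfun v r)"
        by (rule F)
      also have "\<dots> = L * (exp (c * r) * dist (apply_bcontfun w r) (apply_bcontfun v r))"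
        by (simp add: scaleR_diff_right[symmetric] dist_norm)
      also have "\<dots> \<le> L * (exp (c * r) * ?d)"
        using L by (intro mult_left_mono dist_bounded) auto
      finally show "norm (F (exp (c * r) *\<^sub>R apply_bcontfun w r) - F (exp (c * r) *\<^sub>R apply_bcontfun v r))
          \<le> L * ?d * exp (c * r)" by (simp add: mult_ac)
    qed
    then have "norm (I w s - I v s) \<le> ?d / 2 * exp (c * s) - ?d / 2" by (simp add: I0)
    then have *: "norm (I w s - I v s) \<le> ?d / 2 * exp (c * s)"
      by (rule order_trans) simp
    have "dist (P w t) (P v t) = exp (- c * s) * norm (I w s - I v s)"
      by (simp add: P_def dist_norm scaleR_diff_right[symmetric] s_def)
    also have "\<dots> \<le> exp (- c * s) * (?d / 2 * exp (c * s))"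
      using * by (intro mult_left_mono) auto
    also have "\<dots> = ?d / 2" by (simp add: exp_minus)
    finally show "dist (apply_bcontfun (Bcontfun (P w)) t) (apply_bcontfun (Bcontfun (P v)) t) \<le> 1 / 2 * ?d"
      by (simp add: Bcontfun_inverse[OF Pb])
  qed
  obtain w where w: "Bcontfun (P w) = w"
    using banach_fix_type[of "1/2" "\<lambda>w. Bcontfun (P w)"] dP by auto
  define Z where "Z = (\<lambda>t. z + I w t)"
  have Z: "exp (c * t) *\<^sub>R apply_bcontfun w t = Z t" if "t \<in> {0..T}" for t
  proof -
    have "apply_bcontfun w t = P w t" by (metis w Bcontfun_inverse[OF Pb])
    then show ?thesis by (simp add: P_def cl_id[OF that] Z_def exp_minus)
  qed
  have "(Z has_vector_derivative F (Z t)) (at t within {0..T})" if "t \<in> {0..T}" for t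
    using I'[OF that, of w] unfolding Z[OF that] unfolding Z_def
    by (auto intro!: derivative_eq_intros)
  then have "solves_ivp F z T Z" by (simp add: solves_ivp_def Z_def I0)
  then show ?thesis by (intro exI[of _ Z])
qed

text \<open>
  The projection onto a ball is 1-Lipschitz and turns a local Lipschitz bound into a global one.
  A solution of the modified problem solves the original one as long as it stays in the ball.
\<close>

lemma lipschitz_on_cball_ivp_exists:
  fixes F :: "'a::euclidean_space \<Rightarrow> 'a"
  assumes F: "\<And>x y. x \<in> cball c r \<Longrightarrow> y \<in> cball c r \<Longrightarrow> norm (F x - F y) \<le> L * norm (x - y)"
    and L: "0 < L" and T: "0 \<le> T" and r: "0 \<le> r"
  shows "\<exists>Z. solves_ivp (\<lambda>x. F (closest_point (cball c r) x)) z T Z"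
proof (rule lipschitz_ivp_exists[OF _ L T])
  fix x y
  let ?p = "closest_point (cball c r)"
  have ne: "cball c r \<noteq> {}" using r by auto
  have "norm (F (?p x) - F (?p y)) \<le> L * norm (?p x - ?p y)"
    by (intro F closest_point_in_set ne) auto
  also have "\<dots> \<le> L * norm (x - y)"
    using closest_point_lipschitz[OF convex_cball closed_cball ne, of x y] L
    by (intro mult_left_mono) (auto simp: dist_norm)
  finally show "norm (F (?p x) - F (?p y)) \<le> L * norm (x - y)" .
qed

lemma solves_ivp_rescale:
  assumes W: "solves_ivp G z T W" and e: "0 < e" and F: "\<And>x. F x = (1 / e) *\<^sub>R G x"
  shows "solves_ivp F z (e * T) (\<lambda>t. W (t / e))"
  unfolding solves_ivp_def
proof (intro conjI ballI)
  show "W (0 / e) = z" using W by (simp add: solves_ivp_def)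
  fix t assume t: "t \<in> {0..e * T}"
  have im: "(\<lambda>t. t / e) ` {0..e * T} \<subseteq> {0..T}" using e by (auto simp: field_simps)
  have "t / e \<in> {0..T}" using t e by (auto simp: field_simps)
  then have "(W has_vector_derivative G (W (t / e))) (at (t / e) within (\<lambda>t. t / e) ` {0..e * T})"
    using W im unfolding solves_ivp_def by (blast intro: has_vector_derivative_within_subset)
  moreover have "((\<lambda>t. t / e) has_vector_derivative (1 / e)) (at t within {0..e * T})"
    unfolding has_real_derivative_iff_has_vector_derivative[symmetric]
    using e by (auto intro!: derivative_eq_intros)
  ultimately have "(W \<circ> (\<lambda>t. t / e) has_vector_derivative (1 / e) *\<^sub>R G (W (t / e))) (at t within {0..e * T})"
    by (intro vector_diff_chain_within)
  then show "((\<lambda>t. W (t / e)) has_vector_derivative F (W (t / e))) (at t within {0..e * T})"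
    by (simp add: o_def F)
qed

lemma solves_ivp_subset:
  "solves_ivp F z T Z \<Longrightarrow> T' \<le> T \<Longrightarrow> solves_ivp F z T' Z"
  unfolding solves_ivp_def
  by (auto intro!: has_vector_derivative_within_subset[of _ _ _ "{0..T}" "{0..T'}"])

lemma is_flowD:
  assumes "is_flow F \<phi>" "solves_ivp F z T Z" "t \<in> {0..T}" shows "\<phi> z t = Z t"
proof -
  have "0 \<le> T" using assms(3) by simp
  then show ?thesis using assms unfolding is_flow_def by blast
qed

lemma bounded_field_ivp_exists:
  fixes F :: "'a::euclidean_space \<Rightarrow> 'a"
  assumes F: "\<And>x y. x \<in> cball c r \<Longrightarrow> y \<in> cball c r \<Longrightarrow> norm (F x - F y) \<le> L * norm (x - y)"
    and M: "\<And>x. x \<in> cball c r \<Longrightarrow> norm (F x) \<le> M"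
    and L: "0 < L" and T: "0 \<le> T" and r: "0 \<le> r" and MT: "M * T \<le> r"
  shows "\<exists>Z. solves_ivp F c T Z \<and> (\<forall>t\<in>{0..T}. Z t \<in> cball c r)"
proof -
  let ?p = "closest_point (cball c r)"
  have p: "?p x \<in> cball c r" for x using r by (intro closest_point_in_set) auto
  obtain Z where Z: "solves_ivp (\<lambda>x. F (?p x)) c T Z"
    using lipschitz_on_cball_ivp_exists[OF F L T r] by blast
  have M0: "0 \<le> M" using M[of c] r order_trans[OF norm_ge_zero] by auto
  have in_ball: "Z t \<in> cball c r" if t: "t \<in> {0..T}" for t
  proof -
    have "norm (Z t - Z 0) \<le> M * t - M * 0"
    proof (rule norm_increment_le[OF _ _ _ t])
      fix s assume "s \<in> {0..T}"
      then show "(Z has_vector_derivative F (?p (Z s))) (at s within {0..T})"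
        using Z by (simp add: solves_ivp_def)
      show "((\<lambda>s. M * s) has_real_derivative M) (at s within {0..T})"
        by (auto intro!: derivative_eq_intros)
      show "norm (F (?p (Z s))) \<le> M" by (rule M[OF p])
    qed
    moreover have "M * t \<le> M * T" using t M0 by (intro mult_left_mono) auto
    ultimately show ?thesis using Z MT by (simp add: solves_ivp_def dist_norm norm_minus_commute)
  qed
  then have "solves_ivp F c T Z"
    using Z by (auto simp: solves_ivp_def closest_point_self)
  then show ?thesis using in_ball by blast
qed

text \<open>
  The model case is the field \<open>G = (\<epsilon> f, g)\<close> in fast time, with \<open>B\<close> its linearization for \<open>\<epsilon> = 0\<close>.
\<close>

context
  fixes B G :: "'a::euclidean_space \<Rightarrow> 'a" and c :: 'a and r N T \<delta> :: real
  assumes B: "linear B" "\<And>v. norm (B v) \<le> N * norm v" and N: "0 \<le> N" and T: "0 \<le> T"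
    and G: "\<And>x y. x \<in> cball c r \<Longrightarrow> y \<in> cball c r \<Longrightarrow>
      norm (G x - G y - B (x - y)) \<le> \<delta> * norm (x - y)"
    and d: "0 \<le> \<delta>" "\<delta> \<le> 1"
begin

lemma near_linear_lipschitz:
  assumes "x \<in> cball c r" "y \<in> cball c r"
  shows "norm (G x - G y) \<le> (N + 1) * norm (x - y)"
proof -
  have "norm (G x - G y) \<le> norm (G x - G y - B (x - y)) + norm (B (x - y))"
    using norm_triangle_ineq[of "G x - G y - B (x - y)" "B (x - y)"] by simp
  also have "\<dots> \<le> 1 * norm (x - y) + N * norm (x - y)"
    using d by (intro add_mono order_trans[OF G[OF assms]] B(2) mult_right_mono) auto
  finally show ?thesis by (simp add: algebra_simps)
qed

lemma near_linear_ivp_exists: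
  assumes r: "0 \<le> r" and Gc: "norm (G c) * T * exp ((N + 1) * T) \<le> r / 2"
    and z: "norm (z - c) * exp ((N + 1) * T) \<le> r / 2"
  shows "\<exists>Z. solves_ivp G z T Z \<and> (\<forall>t\<in>{0..T}. Z t \<in> cball c r)"
proof -
  let ?p = "closest_point (cball c r)"
  have ne: "cball c r \<noteq> {}" using r by auto
  have p: "?p x \<in> cball c r" for x using ne by (intro closest_point_in_set) auto
  have pc: "?p c = c" using r by (intro closest_point_self) auto
  obtain Z where Z: "solves_ivp (\<lambda>x. G (?p x)) z T Z"
    using lipschitz_on_cball_ivp_exists[OF near_linear_lipschitz _ T r] N by force
  have in_ball: "Z t \<in> cball c r" if t: "t \<in> {0..T}" for t
  proof -
    have "norm (Z t - c) \<le> (norm (Z 0 - c) + norm (G c) * t) * exp ((N + 1) * t)"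
    proof (rule gronwall_affine[OF _ _ _ _ t, where u = "\<lambda>t. Z t - c" and u' = "\<lambda>t. G (?p (Z t))"])
      fix s assume "s \<in> {0..T}"
      then show "((\<lambda>t. Z t - c) has_vector_derivative G (?p (Z s))) (at s within {0..T})"
        using Z by (auto simp: solves_ivp_def intro!: derivative_eq_intros)
      have "norm (G (?p (Z s))) \<le> norm (G c) + norm (G (?p (Z s)) - G c)"
        using norm_triangle_ineq[of "G c" "G (?p (Z s)) - G c"] by simp
      also have "norm (G (?p (Z s)) - G c) \<le> (N + 1) * norm (?p (Z s) - ?p c)"
        using near_linear_lipschitz[OF p p, of "Z s" c] by (simp add: pc)
      also have "\<dots> \<le> (N + 1) * norm (Z s - c)"
        using closest_point_lipschitz[OF convex_cball closed_cball ne, of "Z s" c] N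
        by (intro mult_left_mono) (auto simp: dist_norm)
      finally show "norm (G (?p (Z s))) \<le> norm (G c) + (N + 1) * norm (Z s - c)" by simp
    qed (use N in auto)
    also have "\<dots> \<le> (norm (z - c) + norm (G c) * T) * exp ((N + 1) * T)"
      using Z t N T by (intro mult_mono add_mono) (auto simp: solves_ivp_def intro!: mult_left_mono)
    also have "\<dots> \<le> r" using Gc z by (simp add: algebra_simps)
    finally show ?thesis by (simp add: dist_norm norm_minus_commute)
  qed
  then have "solves_ivp G z T Z"
    using Z by (auto simp: solves_ivp_def closest_point_self)
  then show ?thesis using in_ball by blast
qed

text \<open>
  The deviation \<open>Z1 - Z2 - Y\<close> from the linear flow starts at 0 and is driven only by the
  nonlinear remainder, which is at most \<open>\<delta> |Z1 - Z2|\<close>.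
\<close>

lemma near_linear_flow_difference:
  assumes Z1: "solves_ivp G z1 T Z1" "\<And>t. t \<in> {0..T} \<Longrightarrow> Z1 t \<in> cball c r"
    and Z2: "solves_ivp G z2 T Z2" "\<And>t. t \<in> {0..T} \<Longrightarrow> Z2 t \<in> cball c r"
    and Y: "solves_ivp B (z1 - z2) T Y" and t: "t \<in> {0..T}"
  shows "norm (Z1 t - Z2 t - Y t) \<le> \<delta> * T * exp (2 * (N + 1) * T) * norm (z1 - z2)"
proof -
  let ?L = "N + 1" and ?d = "norm (z1 - z2)"
  have Z': "(Z1 has_vector_derivative G (Z1 s)) (at s within {0..T})"
    "(Z2 has_vector_derivative G (Z2 s)) (at s within {0..T})"
    "(Y has_vector_derivative B (Y s)) (at s within {0..T})" if "s \<in> {0..T}" for s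
    using Z1(1) Z2(1) Y that by (auto simp: solves_ivp_def)
  have init: "Z1 0 = z1" "Z2 0 = z2" "Y 0 = z1 - z2" using Z1(1) Z2(1) Y by (auto simp: solves_ivp_def)
  have mono: "exp (?L * s) \<le> exp (?L * T)" if "s \<in> {0..T}" for s
    using that N by (auto intro!: mult_left_mono)
  have diff: "norm (Z1 s - Z2 s) \<le> ?d * exp (?L * T)" if s: "s \<in> {0..T}" for s
  proof -
    have "norm (Z1 s - Z2 s) \<le> (norm (Z1 0 - Z2 0) + 0 * s) * exp (?L * s)"
    proof (rule gronwall_affine[OF _ _ _ _ s, where u = "\<lambda>t. Z1 t - Z2 t" and u' = "\<lambda>t. G (Z1 t) - G (Z2 t)"])
      fix s assume s: "s \<in> {0..T}"
      show "((\<lambda>t. Z1 t - Z2 t) has_vector_derivative G (Z1 s) - G (Z2 s)) (at s within {0..T})"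
        by (intro has_vector_derivative_diff Z' s)
      show "norm (G (Z1 s) - G (Z2 s)) \<le> 0 + ?L * norm (Z1 s - Z2 s)"
        using near_linear_lipschitz[OF Z1(2)[OF s] Z2(2)[OF s]] by simp
    qed (use N in auto)
    also have "\<dots> \<le> ?d * exp (?L * T)"
      unfolding init using mono[OF s] by (auto intro!: mult_left_mono)
    finally show ?thesis .
  qed
  have "norm (Z1 t - Z2 t - Y t)
      \<le> (norm (Z1 0 - Z2 0 - Y 0) + \<delta> * (?d * exp (?L * T)) * t) * exp (?L * t)"
  proof (rule gronwall_affine[OF _ _ _ _ t, where u = "\<lambda>t. Z1 t - Z2 t - Y t"
        and u' = "\<lambda>t. G (Z1 t) - G (Z2 t) - B (Y t)"])
    fix s assume s: "s \<in> {0..T}"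
    show "((\<lambda>t. Z1 t - Z2 t - Y t) has_vector_derivative G (Z1 s) - G (Z2 s) - B (Y s)) (at s within {0..T})"
      by (intro has_vector_derivative_diff Z' s)
    have "G (Z1 s) - G (Z2 s) - B (Y s)
        = (G (Z1 s) - G (Z2 s) - B (Z1 s - Z2 s)) + B (Z1 s - Z2 s - Y s)"
      by (simp add: linear_diff[OF B(1)])
    then have "norm (G (Z1 s) - G (Z2 s) - B (Y s))
        \<le> norm (G (Z1 s) - G (Z2 s) - B (Z1 s - Z2 s)) + norm (B (Z1 s - Z2 s - Y s))"
      by (metis norm_triangle_ineq)
    also have "\<dots> \<le> \<delta> * norm (Z1 s - Z2 s) + N * norm (Z1 s - Z2 s - Y s)"
      by (intro add_mono G Z1(2) Z2(2) s B(2))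
    also have "\<dots> \<le> \<delta> * (?d * exp (?L * T)) + ?L * norm (Z1 s - Z2 s - Y s)"
      using diff[OF s] d by (intro add_mono mult_left_mono mult_right_mono) auto
    finally show "norm (G (Z1 s) - G (Z2 s) - B (Y s))
        \<le> \<delta> * (?d * exp (?L * T)) + ?L * norm (Z1 s - Z2 s - Y s)" .
  qed (use N d in auto)
  also have "\<dots> = \<delta> * (?d * exp (?L * T)) * t * exp (?L * t)" by (simp add: init)
  also have "\<dots> \<le> \<delta> * (?d * exp (?L * T)) * T * exp (?L * T)"
    using t d mono[OF t] by (intro mult_mono mult_left_mono) auto
  also have "\<dots> = \<delta> * T * (exp (?L * T) * exp (?L * T)) * ?d" by (simp add: algebra_simps)
  also have "exp (?L * T) * exp (?L * T) = exp (2 * ?L * T)"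
    by (simp add: exp_add[symmetric] algebra_simps)
  finally show ?thesis .
qed

end

section \<open>Linear flows of Hurwitz matrices\<close>

lemma linear_ivp_unique:
  fixes A :: "'a::euclidean_space \<Rightarrow> 'a"
  assumes A: "linear A" and U: "solves_ivp A w T U" and V: "solves_ivp A w T V" and t: "t \<in> {0..T}"
  shows "U t = V t"
proof -
  obtain L where L: "0 < L" "\<And>v. norm (A v) \<le> L * norm v"
    using linear_bounded_pos[OF A] by blast
  have "norm (U t - V t) \<le> (norm (U 0 - V 0) + 0 * t) * exp (L * t)"
  proof (rule gronwall_affine[where u = "\<lambda>t. U t - V t", OF _ _ _ _ t])
    fix r assume "r \<in> {0..T}"
    then show "((\<lambda>t. U t - V t) has_vector_derivative A (U r) - A (V r)) (at r within {0..T})"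
      using U V unfolding solves_ivp_def by (intro has_vector_derivative_diff) auto
    show "norm (A (U r) - A (V r)) \<le> 0 + L * norm (U r - V r)"
      using L(2)[of "U r - V r"] by (simp add: linear_diff[OF A])
  qed (use L in auto)
  then show ?thesis using U V by (simp add: solves_ivp_def)
qed

lemma linear_ivp_exists:
  fixes A :: "'a::euclidean_space \<Rightarrow> 'a"
  assumes A: "linear A" and "0 \<le> T"
  shows "\<exists>U. solves_ivp A w T U"
proof -
  obtain L where L: "0 < L" "\<And>v. norm (A v) \<le> L * norm v"
    using linear_bounded_pos[OF A] by blast
  show ?thesis
    by (rule lipschitz_ivp_exists[OF _ L(1) assms(2)]) (simp add: L(2) linear_diff[OF A, symmetric])
qed

text \<open>
  The flow \<open>S\<close> of a linear equation, the matrix exponential of \<open>t A\<close>. Its algebraic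
  properties all follow from uniqueness of solutions.
\<close>

context
  fixes A :: "'a::euclidean_space \<Rightarrow> 'a" and T :: real and S :: "real \<Rightarrow> 'a \<Rightarrow> 'a"
  assumes A: "linear A" and S: "\<And>w. solves_ivp A w T (\<lambda>t. S t w)"
begin

lemma linear_flow_linear:
  assumes t: "t \<in> {0..T}" shows "linear (S t)"
proof (rule linearI)
  fix v w c
  have "solves_ivp A (v + w) T (\<lambda>t. S t v + S t w)"
    using S[of v] S[of w] unfolding solves_ivp_def
    by (auto intro!: derivative_eq_intros simp: linear_add[OF A])
  then show "S t (v + w) = S t v + S t w"
    using linear_ivp_unique[OF A S _ t] by blast
  have "solves_ivp A (c *\<^sub>R v) T (\<lambda>t. c *\<^sub>R S t v)"
    using S[of v] unfolding solves_ivp_def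
    by (auto intro!: derivative_eq_intros simp: linear_cmul[OF A])
  then show "S t (c *\<^sub>R v) = c *\<^sub>R S t v"
    using linear_ivp_unique[OF A S _ t] by blast
qed

lemma linear_flow_add:
  assumes s: "0 \<le> s" "0 \<le> t" "s + t \<le> T" shows "S (s + t) w = S t (S s w)"
proof -
  have "solves_ivp A (S s w) (T - s) (\<lambda>r. S (s + r) w)"
    unfolding solves_ivp_def
  proof (intro conjI ballI)
    fix r assume r: "r \<in> {0..T - s}"
    have im: "(\<lambda>r. s + r) ` {0..T - s} \<subseteq> {0..T}" using s by auto
    have "((\<lambda>t. S t w) has_vector_derivative A (S (s + r) w)) (at (s + r) within (\<lambda>r. s + r) ` {0..T - s})"
      using S[of w] r s im unfolding solves_ivp_def
      by (intro has_vector_derivative_within_subset[OF _ im]) auto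
    moreover have "((\<lambda>r. s + r) has_vector_derivative 1) (at r within {0..T - s})"
      by (auto intro!: derivative_eq_intros)
    ultimately show "((\<lambda>r. S (s + r) w) has_vector_derivative A (S (s + r) w)) (at r within {0..T - s})"
      using vector_diff_chain_within by (fastforce simp: o_def)
  qed simp
  moreover have "solves_ivp A (S s w) (T - s) (\<lambda>t. S t (S s w))"
    using S[of "S s w"] s unfolding solves_ivp_def
    by (auto intro!: has_vector_derivative_within_subset[of _ _ _ "{0..T}" "{0..T - s}"])
  ultimately show ?thesis using s by (intro linear_ivp_unique[OF A]) auto
qed

lemma linear_flow_funpow:
  assumes "0 \<le> s" "real l * s \<le> T" shows "S (real l * s) w = (S s ^^ l) w"
  using assms(2)
proof (induction l)
  case 0
  then show ?case using S[of w] by (simp add: solves_ivp_def)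
next
  case (Suc l)
  have "S (real l * s + s) w = S s (S (real l * s) w)"
    using Suc.prems assms(1) by (intro linear_flow_add) (auto simp: algebra_simps)
  also have "S (real l * s) w = (S s ^^ l) w"
    using Suc.prems assms(1) by (intro Suc.IH) (auto simp: algebra_simps)
  finally show ?case by (simp add: algebra_simps)
qed

text \<open>
  Compactness of \<open>{c1..c2}\<close> and of the unit sphere makes the injectivity of \<open>S s - 1\<close> uniform in \<open>s\<close>.
\<close>

lemma linear_flow_minus_id_bounded_below:
  assumes nofix: "\<And>s w. 0 < s \<Longrightarrow> s \<le> T \<Longrightarrow> S s w = w \<Longrightarrow> w = 0"
    and c: "0 < c1" "c1 \<le> c2" "c2 \<le> T"
  shows "\<exists>k>0. \<forall>s\<in>{c1..c2}. \<forall>w. k * norm w \<le> norm (S s w - w)"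
proof -
  let ?K = "{c1..c2} \<times> sphere (0::'a) 1"
  let ?f = "\<lambda>(s, w). norm (S s w - w)"
  have lin: "S s w = (\<Sum>b\<in>Basis. (w \<bullet> b) *\<^sub>R S s b)" if "s \<in> {0..T}" for s w
    by (rule linear_basis_expand[OF linear_flow_linear[OF that]])
  have cS: "continuous_on {0..T} (\<lambda>s. S s b)" for b
    using S[of b] unfolding solves_ivp_def by (intro continuous_on_vector_derivative) auto
  have "continuous_on ?K (\<lambda>p. norm ((\<Sum>b\<in>Basis. (snd p \<bullet> b) *\<^sub>R S (fst p) b) - snd p))"
    using c by (intro continuous_intros continuous_on_compose2[OF cS]) auto
  then have cont: "continuous_on ?K ?f"
    by (rule continuous_on_eq) (use c lin in auto)
  have ne: "?K \<noteq> {}" using c by auto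
  obtain p where p: "p \<in> ?K" "\<And>q. q \<in> ?K \<Longrightarrow> ?f p \<le> ?f q"
    using continuous_attains_inf[OF _ ne cont] by (auto simp: compact_Times)
  have "0 < ?f p" using p(1) c nofix[of "fst p" "snd p"] by (auto split: prod.splits)
  moreover have "?f p * norm w \<le> norm (S s w - w)" if s: "s \<in> {c1..c2}" for s w
  proof (cases "w = 0")
    case False
    let ?u = "(1 / norm w) *\<^sub>R w"
    have "?f p \<le> norm (S s ?u - ?u)" using p(2)[of "(s, ?u)"] s False by simp
    also have "S s ?u - ?u = (1 / norm w) *\<^sub>R (S s w - w)"
      using linear_flow_linear[of s] s c by (simp add: linear_cmul scaleR_diff_right)
    finally have "?f p \<le> norm (S s w - w) / norm w" by simp
    then show ?thesis using False by (simp add: pos_le_divide_eq)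
  qed simp
  ultimately show ?thesis by blast
qed

end

text \<open>
  The vector \<open>P(M) v\<close> for a complex polynomial \<open>P\<close>.
\<close>

definition poly_mv :: "complex^'n^'n \<Rightarrow> complex poly \<Rightarrow> complex^'n \<Rightarrow> complex^'n" where
  "poly_mv M P v = (\<Sum>i\<le>degree P. coeff P i *s (((*v) M) ^^ i) v)"

lemma poly_mv_eq: "degree P \<le> n \<Longrightarrow> poly_mv M P v = (\<Sum>i\<le>n. coeff P i *s (((*v) M) ^^ i) v)"
  unfolding poly_mv_def by (rule sum.mono_neutral_left) (auto simp: coeff_eq_0)

lemma poly_mv_linear_factor:
  "poly_mv M ([:- l, 1:] * Q) v = poly_mv M Q (M *v v - l *s v)"
proof -
  let ?n = "degree Q"
  have pow: "(((*v) M) ^^ i) (M *v v - l *s v) = (((*v) M) ^^ Suc i) v - l *s (((*v) M) ^^ i) v" for i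
    by (induction i) (auto simp: matrix_vector_mult_diff_distrib vector_scalar_commute)
  have "degree ([:- l, 1:] * Q) \<le> Suc ?n"
    using degree_mult_le[of "[:- l, 1:]" Q] by simp
  then have "poly_mv M ([:- l, 1:] * Q) v
      = (\<Sum>i\<le>Suc ?n. coeff ([:- l, 1:] * Q) i *s (((*v) M) ^^ i) v)" by (rule poly_mv_eq)
  also have "\<dots> = (\<Sum>i\<le>Suc ?n. coeff (pCons 0 Q) i *s (((*v) M) ^^ i) v)
      - (\<Sum>i\<le>Suc ?n. (l * coeff Q i) *s (((*v) M) ^^ i) v)"
    by (simp only: sum_subtractf[symmetric] vector_sub_rdistrib[symmetric]) (simp add: algebra_simps)
  also have "(\<Sum>i\<le>Suc ?n. coeff (pCons 0 Q) i *s (((*v) M) ^^ i) v)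
      = (\<Sum>i\<le>?n. coeff Q i *s (((*v) M) ^^ Suc i) v)"
    unfolding sum.atMost_Suc_shift[of _ ?n] by (simp add: vector_smult_lzero)
  also have "(\<Sum>i\<le>Suc ?n. (l * coeff Q i) *s (((*v) M) ^^ i) v)
      = (\<Sum>i\<le>?n. (l * coeff Q i) *s (((*v) M) ^^ i) v)"
    by (simp add: coeff_eq_0 vector_smult_lzero)
  also have "(\<Sum>i\<le>?n. coeff Q i *s (((*v) M) ^^ Suc i) v) - \<dots>
      = (\<Sum>i\<le>?n. coeff Q i *s (((*v) M) ^^ i) (M *v v - l *s v))"
    unfolding sum_subtractf[symmetric] pow
    by (intro sum.cong refl) (simp add: vector_ssub_ldistrib vector_smult_assoc mult.commute)
  finally show ?thesis by (simp add: poly_mv_def)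
qed

text \<open>
  The iterates \<open>v, M v, M\<^sup>2 v, \<dots>\<close> are linearly dependent.
\<close>

lemma annihilating_poly_exists:
  fixes v :: "complex^'n"
  shows "\<exists>P. P \<noteq> 0 \<and> poly_mv M P v = 0"
proof -
  let ?d = "DIM(complex^'n)" and ?x = "\<lambda>i. (((*v) M) ^^ i) v"
  have "\<exists>c. (\<exists>i\<le>?d. c i \<noteq> 0) \<and> (\<Sum>i\<le>?d. c i *\<^sub>R ?x i) = 0"
  proof (cases "inj_on ?x {..?d}")
    case True
    then have "card (?x ` {..?d}) > ?d" by (simp add: card_image)
    then have "dependent (?x ` {..?d})" using dependent_biggerset[of "?x ` {..?d}"] by simp
    then obtain u where u: "\<exists>y\<in>?x ` {..?d}. u y \<noteq> 0" "(\<Sum>y\<in>?x ` {..?d}. u y *\<^sub>R y) = 0"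
      using dependent_finite[of "?x ` {..?d}"] by auto
    have "(\<Sum>i\<le>?d. u (?x i) *\<^sub>R ?x i) = 0"
      using u(2) sum.reindex[OF True, of "\<lambda>y. u y *\<^sub>R y"] by (simp add: o_def)
    moreover have "\<exists>i\<le>?d. u (?x i) \<noteq> 0" using u(1) by blast
    ultimately show ?thesis by (intro exI[of _ "\<lambda>i. u (?x i)"]) blast
  next
    case False
    then obtain i j where ij: "i \<le> ?d" "j \<le> ?d" "i \<noteq> j" "?x i = ?x j" by (auto simp: inj_on_def)
    \<comment> \<open>two equal iterates give the relation \<open>M\<^sup>i v - M\<^sup>j v = 0\<close>\<close>
    have "(\<Sum>k\<le>?d. ((if k = i then 1 else 0) - (if k = j then 1 else 0)) *\<^sub>R ?x k) = ?x i - ?x j"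
      using ij by (simp add: scaleR_diff_left sum_subtractf if_distrib[of "\<lambda>r. r *\<^sub>R _"] cong: if_cong)
    then show ?thesis using ij
      by (intro exI[of _ "\<lambda>k. (if k = i then 1 else 0) - (if k = j then 1 else 0)"]) (auto intro!: exI[of _ i])
  qed
  then obtain c i where c: "i \<le> ?d" "c i \<noteq> 0" "(\<Sum>i\<le>?d. c i *\<^sub>R ?x i) = 0" by blast
  define P where "P = Abs_poly (\<lambda>i. if i \<le> ?d then complex_of_real (c i) else 0)"
  have cP: "coeff P i = (if i \<le> ?d then complex_of_real (c i) else 0)" for i
    unfolding P_def by (subst Abs_poly_inverse) (auto simp: MOST_nat intro!: exI[of _ ?d])
  have "degree P \<le> ?d" by (rule degree_le) (simp add: cP)
  then have "poly_mv M P v = (\<Sum>i\<le>?d. c i *\<^sub>R ?x i)"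
    by (subst poly_mv_eq) (auto intro!: sum.cong simp: cP vec_eq_iff complex_eq_iff)
  moreover have "P \<noteq> 0" using cP[of i] c by auto
  ultimately show ?thesis using c by metis
qed

text \<open>
  Induction on the degree of a polynomial that annihilates the starting point. If \<open>l\<close> is one of its
  roots then \<open>V = (M - l) U\<close> is again a periodic solution, annihilated by a polynomial of smaller
  degree. Once \<open>V\<close> vanishes, \<open>U\<close> consists of eigenvectors and \<open>U t = exp (l t) U 0\<close>, so
  periodicity forces \<open>Re l = 0\<close>.
\<close>

lemma periodic_orbit_imaginary_eigenvalue_aux:
  fixes M :: "complex^'n^'n"
  assumes "0 < s" "solves_ivp ((*v) M) (U 0) s U" "U s = U 0" "U 0 \<noteq> 0"
    "P \<noteq> 0" "poly_mv M P (U 0) = 0"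
  shows "\<exists>l v. v \<noteq> 0 \<and> M *v v = l *s v \<and> Re l = 0"
  using assms(2-)
proof (induction "degree P" arbitrary: P U)
  case 0
  then obtain a where "P = [:a:]" by (metis degree_eq_zeroE)
  with 0 show ?case by (simp add: poly_mv_def)
next
  case (Suc d)
  have "\<not> (\<exists>a l. a \<noteq> 0 \<and> l = 0 \<and> P = pCons a l)" using Suc.hyps(2) by auto
  then obtain l where "poly P l = 0" using fundamental_theorem_of_algebra_alt by blast
  then obtain Q where Q: "P = [:- l, 1:] * Q" by (metis poly_eq_0_iff_dvd dvdE)
  with Suc.prems have "Q \<noteq> 0" by auto
  have "degree P = Suc (degree Q)" unfolding Q using \<open>Q \<noteq> 0\<close> by (subst degree_mult_eq) auto
  then have dQ: "d = degree Q" using Suc.hyps(2) by simp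
  have linM: "linear ((*v) M)" by (rule bounded_linear.linear) simp
  define V where "V = (\<lambda>t. M *v U t - l *s U t)"
  have smult: "bounded_linear (\<lambda>x::complex^'n. l *s x)"
    by (rule linear_conv_bounded_linear[THEN iffD1], rule linearI)
      (auto simp: vector_add_ldistrib vec_eq_iff)
  have U: "(U has_vector_derivative M *v U t) (at t within {0..s})" if "t \<in> {0..s}" for t
    using Suc.prems(1) that by (simp add: solves_ivp_def)
  have V: "solves_ivp ((*v) M) (V 0) s V"
    unfolding solves_ivp_def V_def
  proof (intro conjI ballI refl)
    fix t assume t: "t \<in> {0..s}"
    have "((\<lambda>t. M *v U t - l *s U t) has_vector_derivative M *v (M *v U t) - l *s (M *v U t)) (at t within {0..s})"
      by (intro has_vector_derivative_diff bounded_linear.has_vector_derivative[OF smult]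
          bounded_linear.has_vector_derivative[OF matrix_vector_mul_bounded_linear] U t)
    then show "((\<lambda>t. M *v U t - l *s U t) has_vector_derivative M *v (M *v U t - l *s U t)) (at t within {0..s})"
      by (simp add: matrix_vector_mult_diff_distrib vector_scalar_commute)
  qed
  have PQ: "poly_mv M Q (V 0) = 0"
    using Suc.prems(5) by (simp add: V_def Q poly_mv_linear_factor del: mult_pCons_left)
  show ?case
  proof (cases "V 0 = 0")
    case False
    show ?thesis
      by (rule Suc.hyps(1)[OF dQ V _ False \<open>Q \<noteq> 0\<close> PQ]) (simp add: V_def Suc.prems(2))
  next
    case True
    have "solves_ivp ((*v) M) 0 s (\<lambda>t. 0)" by (simp add: solves_ivp_def)
    then have "V t = 0" if "t \<in> {0..s}" for t
      using linear_ivp_unique[OF linM V _ that] True by metis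
    then have MU: "M *v U t = l *s U t" if "t \<in> {0..s}" for t using that by (simp add: V_def)
    obtain j where j: "U 0 $ j \<noteq> 0" using Suc.prems(3) by (auto simp: vec_eq_iff)
    \<comment> \<open>one nonzero component suffices to read off \<open>exp (- l s) = 1\<close>\<close>
    define d where "d = (\<lambda>t. exp (- of_real t * l) * U t $ j)"
    have "(d has_vector_derivative 0) (at t within {0..s})" if t: "t \<in> {0..s}" for t
    proof -
      have "((\<lambda>t. U t $ j) has_vector_derivative l * U t $ j) (at t within {0..s})"
        using bounded_linear.has_vector_derivative[OF bounded_linear_vec_nth U[OF t], of j] MU[OF t] by simp
      moreover have "((\<lambda>t. exp (- of_real t * l)) has_vector_derivative - l * exp (- of_real t * l)) (at t within {0..s})"
      proof -
        have "((\<lambda>z. exp (- z * l)) has_field_derivative - l * exp (- of_real t * l)) (at (of_real t))"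
          by (auto intro!: derivative_eq_intros)
        then show ?thesis
          by (intro has_vector_derivative_at_within[OF has_vector_derivative_real_field])
      qed
      ultimately have "(d has_vector_derivative
          exp (- of_real t * l) * (l * U t $ j) + (- l * exp (- of_real t * l)) * U t $ j) (at t within {0..s})"
        unfolding d_def by (rule has_vector_derivative_mult[rotated])
      then show ?thesis by (simp add: algebra_simps)
    qed
    then obtain c where "\<And>t. t \<in> {0..s} \<Longrightarrow> d t = c"
      using has_vector_derivative_zero_constant[of "{0..s}" d] by auto
    then have "d s = d 0" using \<open>0 < s\<close> by simp
    then have "exp (- of_real s * l) = 1" using j Suc.prems(2) by (simp add: d_def)
    then have "norm (exp (- of_real s * l)) = 1" by simp
    then have "Re l = 0" using \<open>0 < s\<close> by simp
    moreover have "M *v U 0 = l *s U 0" using MU[of 0] \<open>0 < s\<close> by simp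
    ultimately show ?thesis using Suc.prems(3) by blast
  qed
qed

lemma hurwitz_no_periodic_orbit:
  fixes A :: "real^'n^'n"
  assumes A: "\<And>l. complex_eigenvalue A l \<Longrightarrow> Re l < 0"
    and U: "solves_ivp ((*v) A) w s U" "0 < s" "U s = w"
  shows "w = 0"
proof (rule ccontr)
  assume "w \<noteq> 0"
  let ?c = "\<lambda>v::real^'n. (\<chi> i. complex_of_real (v $ i)) :: complex^'n"
  let ?M = "map_matrix complex_of_real A"
  have c: "bounded_linear ?c"
    by (rule linear_conv_bounded_linear[THEN iffD1], rule linearI)
      (auto simp: vec_eq_iff complex_eq_iff)
  have M: "?c (A *v v) = ?M *v ?c v" for v
    by (simp add: vec_eq_iff matrix_vector_mult_def)
  have U0: "U 0 = w" using U by (simp add: solves_ivp_def)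
  have "solves_ivp ((*v) ?M) (?c (U 0)) s (\<lambda>t. ?c (U t))"
    using U(1) bounded_linear.has_vector_derivative[OF c] unfolding solves_ivp_def M[symmetric] by blast
  moreover have "?c (U 0) \<noteq> 0" using \<open>w \<noteq> 0\<close> U0 by (auto simp: vec_eq_iff)
  moreover obtain P where "P \<noteq> 0" "poly_mv ?M P (?c (U 0)) = 0"
    using annihilating_poly_exists by blast
  ultimately obtain l v where "v \<noteq> 0" "?M *v v = l *s v" "Re l = 0"
    using periodic_orbit_imaginary_eigenvalue_aux[of s ?M "\<lambda>t. ?c (U t)" P] U U0 by auto
  then show False using A[of l] by (auto simp: complex_eigenvalue_def)
qed

section \<open>Forward differences\<close>

text \<open>
  Detached from the flow, so that induction on the order can replace the sequence by its difference
  sequence.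
\<close>

definition fdiff :: "nat \<Rightarrow> (nat \<Rightarrow> 'a::real_vector) \<Rightarrow> 'a" where
  "fdiff n a = (\<Sum>l\<le>n. ((-1) ^ (n - l) * real (n choose l)) *\<^sub>R a l)"

lemma fdiff_0: "fdiff 0 a = a 0" by (simp add: fdiff_def)

text \<open>
  Pascal's rule for the binomial coefficients.
\<close>

lemma fdiff_Suc: "fdiff (Suc n) a = fdiff n (\<lambda>l. a (Suc l) - a l)"
proof -
  define g where "g = (\<lambda>l. ((-1) ^ (Suc n - l) * real (n choose l)) *\<^sub>R a l)"
  have 1: "((-1) ^ (Suc n - Suc l) * real (Suc n choose Suc l)) *\<^sub>R a (Suc l)
      = ((-1) ^ (n - l) * real (n choose l)) *\<^sub>R a (Suc l) + g (Suc l)" for l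
    by (simp add: g_def algebra_simps)
  have 2: "g l = - (((-1) ^ (n - l) * real (n choose l)) *\<^sub>R a l)" if "l \<le> n" for l
    using that by (simp add: g_def Suc_diff_le)
  have "fdiff (Suc n) a = g 0 + (\<Sum>l\<le>n. ((-1) ^ (n - l) * real (n choose l)) *\<^sub>R a (Suc l) + g (Suc l))"
    unfolding fdiff_def by (subst sum.atMost_Suc_shift) (simp only: 1, simp add: g_def)
  also have "\<dots> = (\<Sum>l\<le>n. ((-1) ^ (n - l) * real (n choose l)) *\<^sub>R a (Suc l)) + (\<Sum>l\<le>Suc n. g l)"
    unfolding sum.atMost_Suc_shift[of g n] by (simp add: sum.distrib)
  also have "(\<Sum>l\<le>Suc n. g l) = (\<Sum>l\<le>n. g l)" by (simp add: g_def)
  also have "\<dots> = - (\<Sum>l\<le>n. ((-1) ^ (n - l) * real (n choose l)) *\<^sub>R a l)"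
    by (simp add: 2 sum_negf)
  finally show ?thesis
    unfolding fdiff_def by (simp add: sum_subtractf scaleR_diff_right)
qed

lemma fdiff_cong: "(\<And>l. l \<le> n \<Longrightarrow> a l = b l) \<Longrightarrow> fdiff n a = fdiff n b"
  unfolding fdiff_def by (intro sum.cong) auto

lemma fdiff_add: "fdiff n (\<lambda>l. a l + b l) = fdiff n a + fdiff n b"
  by (simp add: fdiff_def scaleR_add_right sum.distrib)

lemma fdiff_diff: "fdiff n (\<lambda>l. a l - b l) = fdiff n a - fdiff n b"
  by (simp add: fdiff_def scaleR_diff_right sum_subtractf)

lemma fdiff_sum: "fdiff n (\<lambda>l. \<Sum>i\<in>I. a i l) = (\<Sum>i\<in>I. fdiff n (a i))"
  unfolding fdiff_def scaleR_sum_right by (rule sum.swap)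

lemma fdiff_linear:
  assumes "linear f" shows "fdiff n (\<lambda>l. f (a l)) = f (fdiff n a)"
  unfolding fdiff_def by (simp add: linear_sum[OF assms] linear_cmul[OF assms])

lemma norm_fdiff_le:
  assumes "\<And>l. l \<le> n \<Longrightarrow> norm (a l) \<le> B"
  shows "norm (fdiff n a) \<le> 2 ^ n * B"
  using assms
proof (induction n arbitrary: a B)
  case (Suc n)
  have "norm (a (Suc l) - a l) \<le> 2 * B" if "l \<le> n" for l
    using norm_triangle_ineq4[of "a (Suc l)" "a l"] Suc.prems[of l] Suc.prems[of "Suc l"] that by simp
  then have "norm (fdiff n (\<lambda>l. a (Suc l) - a l)) \<le> 2 ^ n * (2 * B)" by (rule Suc.IH)
  then show ?case by (simp add: fdiff_Suc)
qed (simp add: fdiff_0)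

text \<open>
  Taking differences lowers the degree of a polynomial.
\<close>

lemma fdiff_power:
  "j < n \<Longrightarrow> fdiff n (\<lambda>l. real l ^ j) = (0::real)"
proof (induction n arbitrary: j)
  case (Suc n)
  have "real (Suc l) ^ j - real l ^ j = (\<Sum>i<j. real (j choose i) * real l ^ i)" for l
    using binomial_ring[of "real l" 1 j] by (simp add: add.commute lessThan_Suc_atMost[symmetric])
  then have "fdiff (Suc n) (\<lambda>l. real l ^ j) = fdiff n (\<lambda>l. \<Sum>i<j. real (j choose i) * real l ^ i)"
    by (simp add: fdiff_Suc)
  also have "\<dots> = (\<Sum>i<j. real (j choose i) * fdiff n (\<lambda>l. real l ^ i))"
    unfolding fdiff_sum by (intro sum.cong fdiff_linear refl) (auto intro!: linearI simp: algebra_simps)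
  also have "\<dots> = 0" using Suc by (intro sum.neutral) auto
  finally show ?case .
qed simp

lemma fdiff_polynomial:
  fixes a :: "nat \<Rightarrow> 'a::real_vector"
  shows "fdiff n (\<lambda>l. \<Sum>j<n. (real l * \<tau>) ^ j *\<^sub>R a j) = 0"
proof -
  have "fdiff n (\<lambda>l. (real l * \<tau>) ^ j *\<^sub>R a j) = 0" if "j < n" for j
  proof -
    have "fdiff n (\<lambda>l. (\<lambda>r. r *\<^sub>R (\<tau> ^ j *\<^sub>R a j)) (real l ^ j)) = 0"
      by (subst fdiff_linear) (auto intro!: linearI simp: fdiff_power[OF that] algebra_simps)
    then show ?thesis by (simp add: power_mult_distrib)
  qed
  then show ?thesis by (simp add: fdiff_sum)
qed

text \<open>
  The binomial expansion of \<open>(S - 1)\<^sup>n\<close>.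
\<close>

lemma fdiff_funpow:
  assumes S: "linear S"
  shows "fdiff n (\<lambda>l. (S ^^ l) w) = ((\<lambda>v. S v - v) ^^ n) w"
proof (induction n arbitrary: w)
  case (Suc n)
  have "linear (S ^^ l)" for l
    by (induction l) (auto intro: linear_compose[OF _ S] linear_id simp: linear_id[unfolded id_def] simp del: o_apply)
  then have "(S ^^ Suc l) w - (S ^^ l) w = (S ^^ l) (S w - w)" for l
    by (simp add: linear_diff funpow_swap1)
  then have "fdiff (Suc n) (\<lambda>l. (S ^^ l) w) = fdiff n (\<lambda>l. (S ^^ l) (S w - w))"
    by (simp add: fdiff_Suc)
  then show ?case by (simp only: Suc.IH funpow_Suc_right o_def)
qed (simp add: fdiff_0)

lemma forward_diff_eq_fdiff: "forward_diff \<phi> \<tau> n z = fdiff n (\<lambda>l. snd (\<phi> z (real l * \<tau>)))"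
  by (simp add: forward_diff_def fdiff_def)

section \<open>Forward differences of orbits on the slow manifold\<close>

text \<open>
  The invariance equation says that \<open>y = h x\<close> solves the fast equation along the reduced slow flow.
\<close>

lemma fast_slow_manifold_solution:
  fixes f :: "'a::euclidean_space \<Rightarrow> 'b::euclidean_space \<Rightarrow> real \<Rightarrow> 'a" and h :: "'a \<Rightarrow> 'b"
  assumes h: "smooth_on K h" and \<epsilon>: "\<epsilon> \<noteq> 0"
    and inv: "\<And>x. x \<in> K \<Longrightarrow> g x (h x) \<epsilon> - \<epsilon> *\<^sub>R frechet_derivative h (at x) (f x (h x) \<epsilon>) = 0"
    and X: "solves_ivp (\<lambda>x. f x (h x) \<epsilon>) x0 T X" "\<And>t. t \<in> {0..T} \<Longrightarrow> X t \<in> K"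
  shows "solves_ivp (fast_slow_field f g \<epsilon>) (x0, h x0) T (\<lambda>t. (X t, h (X t)))"
  unfolding solves_ivp_def
proof (intro conjI ballI)
  show "(X 0, h (X 0)) = (x0, h x0)" using X(1) by (simp add: solves_ivp_def)
  fix t assume t: "t \<in> {0..T}"
  let ?w = "f (X t) (h (X t)) \<epsilon>"
  have X': "(X has_vector_derivative ?w) (at t within {0..T})"
    using X(1) t by (simp add: solves_ivp_def)
  have dh: "(h has_derivative frechet_derivative h (at (X t))) (at (X t) within X ` {0..T})"
    using smooth_onD(3)[OF h X(2)[OF t]] by (rule has_derivative_at_withinI)
  have "((\<lambda>t. h (X t)) has_vector_derivative frechet_derivative h (at (X t)) ?w) (at t within {0..T})"
    using vector_derivative_diff_chain_within[OF X' dh] by (simp add: o_def)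
  moreover have "g (X t) (h (X t)) \<epsilon> = \<epsilon> *\<^sub>R frechet_derivative h (at (X t)) ?w"
    using inv[OF X(2)[OF t]] by simp
  then have "frechet_derivative h (at (X t)) ?w = (1 / \<epsilon>) *\<^sub>R g (X t) (h (X t)) \<epsilon>"
    using \<epsilon> by simp
  ultimately show "((\<lambda>t. (X t, h (X t))) has_vector_derivative
      fast_slow_field f g \<epsilon> (X t, h (X t))) (at t within {0..T})"
    using has_vector_derivative_Pair[OF X'] by (simp add: fast_slow_field_def)
qed

text \<open>
  Taylor expansion of \<open>q\<close> along curves that solve \<open>X' = V(X, \<epsilon>)\<close> only up to \<open>O(\<epsilon>\<^sup>N)\<close>. The induction
  is over all smooth \<open>q\<close> at once: an expansion of order \<open>k\<close> of the Lie derivative of \<open>q\<close> along \<open>V\<close>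
  integrates to one of order \<open>k + 1\<close> of \<open>q\<close>. Only derivatives of \<open>q\<close> and \<open>V\<close> enter, and
  these are bounded on the compact set \<open>cball x0 r \<times> {0..e}\<close>, which includes \<open>\<epsilon> = 0\<close>.
\<close>

lemma approximate_flow_expansion:
  fixes V :: "'a::euclidean_space \<times> real \<Rightarrow> 'a" and X W :: "real \<Rightarrow> real \<Rightarrow> 'a"
    and q :: "'a \<times> real \<Rightarrow> 'b::euclidean_space"
  assumes V: "smooth_on \<Omega> V" and sub: "cball x0 r \<times> {0..e} \<subseteq> \<Omega>" and t0: "0 \<le> t0"
    and X: "\<And>\<epsilon> t. 0 < \<epsilon> \<Longrightarrow> \<epsilon> \<le> e \<Longrightarrow> t \<in> {0..t0} \<Longrightarrow>
        (X \<epsilon> has_vector_derivative W \<epsilon> t) (at t within {0..t0})"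
      "\<And>\<epsilon> t. 0 < \<epsilon> \<Longrightarrow> \<epsilon> \<le> e \<Longrightarrow> t \<in> {0..t0} \<Longrightarrow> X \<epsilon> t \<in> cball x0 r"
    and W: "\<And>\<epsilon> t. 0 < \<epsilon> \<Longrightarrow> \<epsilon> \<le> e \<Longrightarrow> t \<in> {0..t0} \<Longrightarrow>
        norm (W \<epsilon> t - V (X \<epsilon> t, \<epsilon>)) \<le> C0 * \<epsilon> ^ N"
    and q: "smooth_on \<Omega> q"
  shows "\<exists>C\<ge>0. \<forall>\<epsilon>. 0 < \<epsilon> \<and> \<epsilon> \<le> e \<longrightarrow> (\<exists>a. \<forall>t\<in>{0..t0}.
    norm (q (X \<epsilon> t, \<epsilon>) - (\<Sum>j<k. t ^ j *\<^sub>R a j)) \<le> C * (t ^ k + \<epsilon> ^ N))"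
  using q
proof (induction k arbitrary: q)
  case 0
  have K: "compact (cball x0 r \<times> {0..e})" by (intro compact_Times) auto
  obtain C where C: "C > 0" "\<And>p. p \<in> cball x0 r \<times> {0..e} \<Longrightarrow> norm (q p) \<le> C"
    using smooth_on_bounded[OF 0 K sub] by blast
  have "norm (q (X \<epsilon> t, \<epsilon>)) \<le> C * (1 + \<epsilon> ^ N)" if "0 < \<epsilon>" "\<epsilon> \<le> e" "t \<in> {0..t0}" for \<epsilon> t
  proof -
    have "norm (q (X \<epsilon> t, \<epsilon>)) \<le> C * 1" using C(2) X(2)[OF that] that by simp
    also have "\<dots> \<le> C * (1 + \<epsilon> ^ N)" using C(1) that by (intro mult_left_mono) auto
    finally show ?thesis .
  qed
  then show ?case using C(1) by (intro exI[of _ C]) simp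
next
  case (Suc k)
  note q = Suc.prems
  let ?D = "\<lambda>z. frechet_derivative q (at z)"
  define Lq where "Lq = (\<lambda>z. ?D z (V z, 0))"
  have o: "open \<Omega>" by (rule smooth_onD(1)[OF q])
  have "smooth_on \<Omega> Lq" unfolding Lq_def
    by (intro smooth_on_directional_derivative[OF q] smooth_on_Pair V smooth_on_const o)
  then obtain C1 where C1: "C1 \<ge> 0" "\<And>\<epsilon>. 0 < \<epsilon> \<Longrightarrow> \<epsilon> \<le> e \<Longrightarrow> \<exists>a. \<forall>t\<in>{0..t0}.
      norm (Lq (X \<epsilon> t, \<epsilon>) - (\<Sum>j<k. t ^ j *\<^sub>R a j)) \<le> C1 * (t ^ k + \<epsilon> ^ N)"
    using Suc.IH by metis
  have "compact (cball x0 r \<times> {0..e})" by (intro compact_Times) auto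
  then obtain L where L: "L > 0"
    "\<And>z v. z \<in> cball x0 r \<times> {0..e} \<Longrightarrow> norm (?D z v) \<le> L * norm v"
    using smooth_on_derivative_bound[OF q _ sub] by metis
  define C2 where "C2 = C1 + L * \<bar>C0\<bar>"
  have C2: "C2 \<ge> 0" using C1(1) L(1) by (simp add: C2_def)
  have "\<exists>a. \<forall>t\<in>{0..t0}. norm (q (X \<epsilon> t, \<epsilon>) - (\<Sum>j<Suc k. t ^ j *\<^sub>R a j))
      \<le> C2 * (1 + t0) * (t ^ Suc k + \<epsilon> ^ N)" if \<epsilon>: "0 < \<epsilon>" "\<epsilon> \<le> e" for \<epsilon>
  proof -
    obtain a where a: "\<And>t. t \<in> {0..t0} \<Longrightarrow>
        norm (Lq (X \<epsilon> t, \<epsilon>) - (\<Sum>j<k. t ^ j *\<^sub>R a j)) \<le> C1 * (t ^ k + \<epsilon> ^ N)"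
      using C1(2)[OF \<epsilon>] by blast
    \<comment> \<open>\<open>P\<close> is the primitive of the expansion of \<open>Lq\<close>, and \<open>b\<close> are the coefficients of
      \<open>q (X 0) + P\<close>\<close>
    define P where "P = (\<lambda>t. \<Sum>j<k. (t ^ Suc j / real (Suc j)) *\<^sub>R a j)"
    define b where "b = (\<lambda>j. if j = 0 then q (X \<epsilon> 0, \<epsilon>) else (1 / real j) *\<^sub>R a (j - 1))"
    have b: "(\<Sum>j<Suc k. t ^ j *\<^sub>R b j) = q (X \<epsilon> 0, \<epsilon>) + P t" for t
      unfolding sum.lessThan_Suc_shift by (simp add: b_def P_def)
    have pw: "((\<lambda>t. t ^ Suc j / real (Suc j)) has_real_derivative t ^ j) (at t within S)" for j t S
    proof -
      have "((\<lambda>t. t ^ Suc j / real (Suc j)) has_real_derivative (real (Suc j) * t ^ j) / real (Suc j)) (at t within S)"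
        by (rule derivative_eq_intros refl | simp)+
      then show ?thesis by simp
    qed
    have P': "(P has_vector_derivative (\<Sum>j<k. t ^ j *\<^sub>R a j)) (at t within S)" for t S
      unfolding P_def
      by (intro has_vector_derivative_sum) (use has_vector_derivative_scaleR[OF pw has_vector_derivative_const] in simp)
    define Q where "Q = (\<lambda>t. q (X \<epsilon> t, \<epsilon>) - P t)"
    have "norm (Q t - Q 0) \<le> C2 * (1 + t0) * (t ^ Suc k + \<epsilon> ^ N)" if t: "t \<in> {0..t0}" for t
    proof -
      have "norm (Q t - Q 0) \<le> C2 * (t ^ Suc k / real (Suc k) + \<epsilon> ^ N * t)
          - C2 * (0 ^ Suc k / real (Suc k) + \<epsilon> ^ N * 0)"
      proof (rule norm_increment_le[OF _ _ _ t, where p = "\<lambda>t. C2 * (t ^ Suc k / real (Suc k) + \<epsilon> ^ N * t)"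
            and u' = "\<lambda>t. ?D (X \<epsilon> t, \<epsilon>) (W \<epsilon> t, 0) - (\<Sum>j<k. t ^ j *\<^sub>R a j)"])
        fix t assume t: "t \<in> {0..t0}"
        let ?z = "(X \<epsilon> t, \<epsilon>)"
        have z: "?z \<in> cball x0 r \<times> {0..e}" using X(2)[OF \<epsilon> t] \<epsilon> by auto
        then have z': "?z \<in> \<Omega>" using sub by auto
        have "((\<lambda>t. (X \<epsilon> t, \<epsilon>)) has_vector_derivative (W \<epsilon> t, 0)) (at t within {0..t0})"
          by (intro has_vector_derivative_Pair X \<epsilon> t has_vector_derivative_const)
        from vector_derivative_diff_chain_within[OF this has_derivative_at_withinI[OF smooth_onD(3)[OF q z']]]
        have "((\<lambda>t. q (X \<epsilon> t, \<epsilon>)) has_vector_derivative ?D ?z (W \<epsilon> t, 0)) (at t within {0..t0})"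
          by (simp add: o_def)
        then show "(Q has_vector_derivative ?D ?z (W \<epsilon> t, 0) - (\<Sum>j<k. t ^ j *\<^sub>R a j)) (at t within {0..t0})"
          unfolding Q_def by (intro has_vector_derivative_diff P')
        show "((\<lambda>t. C2 * (t ^ Suc k / real (Suc k) + \<epsilon> ^ N * t)) has_real_derivative
            C2 * (t ^ k + \<epsilon> ^ N)) (at t within {0..t0})"
          by (intro DERIV_cmult DERIV_add pw DERIV_cmult_Id)
        have lin: "linear (?D ?z)" using smooth_onD(3)[OF q z'] has_derivative_linear by blast
        have split: "?D ?z (W \<epsilon> t, 0) = ?D ?z (W \<epsilon> t - V ?z, 0) + Lq ?z"
          unfolding Lq_def linear_add[OF lin, symmetric] by simp
        have "norm (?D ?z (W \<epsilon> t, 0) - (\<Sum>j<k. t ^ j *\<^sub>R a j))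
            \<le> norm (?D ?z (W \<epsilon> t - V ?z, 0)) + norm (Lq ?z - (\<Sum>j<k. t ^ j *\<^sub>R a j))"
          unfolding split add_diff_eq[symmetric] by (rule norm_triangle_ineq)
        also have "\<dots> \<le> L * (\<bar>C0\<bar> * \<epsilon> ^ N) + C1 * (t ^ k + \<epsilon> ^ N)"
        proof (intro add_mono a t)
          have "norm (?D ?z (W \<epsilon> t - V ?z, 0)) \<le> L * norm (W \<epsilon> t - V ?z)"
            using L(2)[OF z, of "(W \<epsilon> t - V ?z, 0)"] by (simp add: norm_Pair)
          also have "norm (W \<epsilon> t - V ?z) \<le> \<bar>C0\<bar> * \<epsilon> ^ N"
            using W[OF \<epsilon> t] \<epsilon> by (intro order_trans[OF W[OF \<epsilon> t]] mult_right_mono) auto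
          finally show "norm (?D ?z (W \<epsilon> t - V ?z, 0)) \<le> L * (\<bar>C0\<bar> * \<epsilon> ^ N)" using L(1) by simp
        qed
        also have "\<dots> \<le> L * \<bar>C0\<bar> * (t ^ k + \<epsilon> ^ N) + C1 * (t ^ k + \<epsilon> ^ N)"
          using t L(1) \<epsilon> by (simp add: algebra_simps)
        also have "\<dots> = C2 * (t ^ k + \<epsilon> ^ N)" by (simp add: C2_def algebra_simps)
        finally show "norm (?D ?z (W \<epsilon> t, 0) - (\<Sum>j<k. t ^ j *\<^sub>R a j)) \<le> C2 * (t ^ k + \<epsilon> ^ N)" .
      qed
      also have "\<dots> = C2 * (t ^ Suc k / real (Suc k) + \<epsilon> ^ N * t)" by simp
      also have "\<dots> \<le> C2 * ((1 + t0) * t ^ Suc k + \<epsilon> ^ N * (1 + t0))"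
      proof (intro mult_left_mono add_mono C2)
        have "t ^ Suc k / real (Suc k) \<le> t ^ Suc k / 1"
          using t by (intro divide_left_mono) auto
        also have "\<dots> \<le> (1 + t0) * t ^ Suc k" using t t0 by (simp add: algebra_simps)
        finally show "t ^ Suc k / real (Suc k) \<le> (1 + t0) * t ^ Suc k" .
      qed (use t \<epsilon> in auto)
      finally show ?thesis by (simp add: algebra_simps)
    qed
    then have "\<forall>t\<in>{0..t0}. norm (q (X \<epsilon> t, \<epsilon>) - (\<Sum>j<Suc k. t ^ j *\<^sub>R b j))
      \<le> C2 * (1 + t0) * (t ^ Suc k + \<epsilon> ^ N)"
      unfolding b by (auto simp: Q_def P_def algebra_simps)
    then show ?thesis by blast
  qed
  then show ?case using C2 t0 by (intro exI[of _ "C2 * (1 + t0)"]) auto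
qed

text \<open>
  On the time scale \<open>t = O(\<epsilon>)\<close> the error \<open>O(t\<^sup>N + \<epsilon>\<^sup>N)\<close> of the expansion along the slow flow is
  \<open>O(\<epsilon>\<^sup>N)\<close>, and the polynomial part is annihilated by the difference of order \<open>N\<close>.
\<close>

lemma slow_manifold_forward_diff:
  fixes f :: "'a::euclidean_space \<Rightarrow> 'b::euclidean_space \<Rightarrow> real \<Rightarrow> 'a"
    and h :: "real \<Rightarrow> 'a \<Rightarrow> 'b"
  assumes \<epsilon>0: "0 < \<epsilon>0"
    and f: "smooth_on (UNIV \<times> UNIV \<times> {-\<epsilon>0<..<\<epsilon>0}) (\<lambda>(x, y, \<epsilon>). f x y \<epsilon>)"
    and K: "open K" "x0 \<in> K"
    and h: "\<And>\<epsilon>. \<epsilon> \<in> {0<..<\<epsilon>0} \<Longrightarrow> smooth_on K (h \<epsilon>)"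
    and inv: "\<And>\<epsilon> x. \<epsilon> \<in> {0<..<\<epsilon>0} \<Longrightarrow> x \<in> K \<Longrightarrow>
      g x (h \<epsilon> x) \<epsilon> - \<epsilon> *\<^sub>R frechet_derivative (h \<epsilon>) (at x) (f x (h \<epsilon> x) \<epsilon>) = 0"
    and hc: "\<And>i. smooth_on K (hc i)"
    and expansion: "\<And>C. compact C \<Longrightarrow> C \<subseteq> K \<Longrightarrow> \<exists>B. \<forall>\<^sub>F \<epsilon> in at_right 0. \<forall>x\<in>C.
      norm (h \<epsilon> x - (\<Sum>i<N. \<epsilon> ^ i *\<^sub>R hc i x)) \<le> B * \<epsilon> ^ N"
    and flow: "\<And>\<epsilon>. \<epsilon> \<in> {0<..<\<epsilon>0} \<Longrightarrow> is_flow (fast_slow_field f g \<epsilon>) (\<phi> \<epsilon>)"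
    and \<tau>: "\<forall>\<^sub>F \<epsilon> in at_right 0. 0 \<le> \<tau> \<epsilon> \<and> \<tau> \<epsilon> \<le> c * \<epsilon>"
  shows "\<exists>C. \<forall>\<^sub>F \<epsilon> in at_right 0. norm (forward_diff (\<phi> \<epsilon>) (\<tau> \<epsilon>) N (x0, h \<epsilon> x0)) \<le> C * \<epsilon> ^ N"
proof -
  obtain r where r: "r > 0" "cball x0 r \<subseteq> K" using K open_contains_cball by blast
  obtain B where B: "\<forall>\<^sub>F \<epsilon> in at_right 0. \<forall>x\<in>cball x0 r.
      norm (h \<epsilon> x - (\<Sum>i<N. \<epsilon> ^ i *\<^sub>R hc i x)) \<le> B * \<epsilon> ^ N"
    using expansion[OF compact_cball r(2)] by blast
  define p where "p = (\<lambda>z. \<Sum>i<N. snd z ^ i *\<^sub>R hc i (fst z))"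
  let ?\<Omega> = "K \<times> {-\<epsilon>0<..<\<epsilon>0}"
  have o: "open ?\<Omega>" using K by (intro open_Times) auto
  have fst: "smooth_on ?\<Omega> fst" and snd: "smooth_on ?\<Omega> snd"
    by (intro smooth_on_linear o bounded_linear_fst bounded_linear_snd)+
  have p: "smooth_on ?\<Omega> p"
    unfolding p_def
    by (intro smooth_on_sum smooth_on_scaleR smooth_on_power smooth_on_compose[OF hc] fst snd o) auto
  define V where "V = (\<lambda>z. f (fst z) (p z) (snd z))"
  have V: "smooth_on ?\<Omega> V"
    unfolding V_def
    by (rule smooth_on_cong[OF _ smooth_on_compose[OF f smooth_on_Pair[OF fst smooth_on_Pair[OF p snd]]]]) auto
  have sub1: "cball x0 r \<times> {0..\<epsilon>0 / 2} \<subseteq> ?\<Omega>" using r(2) \<epsilon>0 by auto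
  have "compact (cball x0 r \<times> {0..\<epsilon>0 / 2})" by (intro compact_Times) auto
  then obtain Rp where Rp: "Rp > 0" "\<And>z. z \<in> cball x0 r \<times> {0..\<epsilon>0 / 2} \<Longrightarrow> norm (p z) \<le> Rp"
    using smooth_on_bounded[OF p _ sub1] by blast
  \<comment> \<open>radius of a ball that contains the values of \<open>p\<close> and, for \<open>\<epsilon> \<le> 1\<close>, those of \<open>h \<epsilon>\<close>\<close>
  define R where "R = Rp + \<bar>B\<bar>"
  let ?C = "cball x0 r \<times> cball (0::'b) R \<times> {0..\<epsilon>0 / 2}"
  have C: "compact ?C" "?C \<subseteq> UNIV \<times> UNIV \<times> {-\<epsilon>0<..<\<epsilon>0}" "convex ?C"
    using \<epsilon>0 by (auto intro!: compact_Times convex_Times)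
  obtain Lf where Lf: "Lf > 0" "\<And>z z'. z \<in> ?C \<Longrightarrow> z' \<in> ?C \<Longrightarrow>
      norm ((case z of (x, y, \<epsilon>) \<Rightarrow> f x y \<epsilon>) - (case z' of (x, y, \<epsilon>) \<Rightarrow> f x y \<epsilon>)) \<le> Lf * norm (z - z')"
    using smooth_on_lipschitz[OF f C] by blast
  obtain M where M: "M > 0" "\<And>z. z \<in> ?C \<Longrightarrow> norm (case z of (x, y, \<epsilon>) \<Rightarrow> f x y \<epsilon>) \<le> M"
    using smooth_on_bounded[OF f C(1,2)] by blast
  \<comment> \<open>with speed at most \<open>M\<close> the slow orbit cannot leave the ball of radius \<open>r\<close> before \<open>t0\<close>;
    this time does not depend on \<open>\<epsilon>\<close>\<close>
  define t0 where "t0 = r / M"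
  have t0: "t0 > 0" using r M by (simp add: t0_def)
  have "\<forall>\<^sub>F \<epsilon> in at_right 0. \<epsilon> < t0 / (real N * \<bar>c\<bar> + 1)"
    using t0 by (intro eventually_at_right_less order_tendstoD(2)[OF tendsto_ident_at]) (auto intro!: divide_pos_pos add_nonneg_pos)
  moreover have "\<forall>\<^sub>F \<epsilon> in at_right 0. \<epsilon> < min 1 (\<epsilon>0 / 2)"
    using \<epsilon>0 by (intro order_tendstoD(2)[OF tendsto_ident_at]) auto
  ultimately have "\<forall>\<^sub>F \<epsilon> in at_right 0. \<epsilon> < t0 / (real N * \<bar>c\<bar> + 1) \<and> \<epsilon> < min 1 (\<epsilon>0 / 2) \<and>
      (0 \<le> \<tau> \<epsilon> \<and> \<tau> \<epsilon> \<le> c * \<epsilon>) \<and>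
      (\<forall>x\<in>cball x0 r. norm (h \<epsilon> x - (\<Sum>i<N. \<epsilon> ^ i *\<^sub>R hc i x)) \<le> B * \<epsilon> ^ N)"
    using \<tau> B by eventually_elim blast
  then obtain b where b: "b > 0" "\<And>\<epsilon>. 0 < \<epsilon> \<Longrightarrow> \<epsilon> < b \<Longrightarrow>
      \<epsilon> < t0 / (real N * \<bar>c\<bar> + 1) \<and> \<epsilon> < min 1 (\<epsilon>0 / 2) \<and> (0 \<le> \<tau> \<epsilon> \<and> \<tau> \<epsilon> \<le> c * \<epsilon>) \<and>
      (\<forall>x\<in>cball x0 r. norm (h \<epsilon> x - (\<Sum>i<N. \<epsilon> ^ i *\<^sub>R hc i x)) \<le> B * \<epsilon> ^ N)"
    unfolding eventually_at_right_field by blast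
  define e where "e = b / 2"
  have e: "0 < e" using b by (simp add: e_def)
  have \<epsilon>: "\<epsilon> \<in> {0<..<\<epsilon>0}" "\<epsilon> \<in> {0..\<epsilon>0 / 2}" "\<epsilon> \<le> 1" "real N * c * \<epsilon> \<le> t0" "0 \<le> \<tau> \<epsilon>" "\<tau> \<epsilon> \<le> c * \<epsilon>"
    "\<And>x. x \<in> cball x0 r \<Longrightarrow> norm (h \<epsilon> x - p (x, \<epsilon>)) \<le> \<bar>B\<bar> * \<epsilon> ^ N"
    if "0 < \<epsilon>" "\<epsilon> \<le> e" for \<epsilon>
  proof -
    note * = b(2)[OF that(1)]
    have lt: "\<epsilon> < b" using that b by (simp add: e_def)
    show "\<epsilon> \<in> {0<..<\<epsilon>0}" "\<epsilon> \<in> {0..\<epsilon>0 / 2}" "\<epsilon> \<le> 1" "0 \<le> \<tau> \<epsilon>" "\<tau> \<epsilon> \<le> c * \<epsilon>"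
      using *[OF lt] that \<epsilon>0 by auto
    have pos: "0 < real N * \<bar>c\<bar> + 1" by (intro add_nonneg_pos) auto
    have "\<epsilon> * (real N * \<bar>c\<bar> + 1) < t0" using *[OF lt] pos by (simp add: pos_less_divide_eq)
    moreover have "real N * c * \<epsilon> \<le> \<epsilon> * (real N * \<bar>c\<bar> + 1)"
    proof -
      have "real N * c * \<epsilon> \<le> real N * \<bar>c\<bar> * \<epsilon>"
        using that by (intro mult_right_mono mult_left_mono) auto
      also have "\<dots> \<le> \<epsilon> * (real N * \<bar>c\<bar> + 1)" using that by (simp add: algebra_simps)
      finally show ?thesis .
    qed
    ultimately show "real N * c * \<epsilon> \<le> t0" by linarith
    fix x assume "x \<in> cball x0 r"
    then have "norm (h \<epsilon> x - p (x, \<epsilon>)) \<le> B * \<epsilon> ^ N" using *[OF lt] by (simp add: p_def)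
    also have "\<dots> \<le> \<bar>B\<bar> * \<epsilon> ^ N" using that by (intro mult_right_mono) auto
    finally show "norm (h \<epsilon> x - p (x, \<epsilon>)) \<le> \<bar>B\<bar> * \<epsilon> ^ N" .
  qed
  have hR: "(x, h \<epsilon> x, \<epsilon>) \<in> ?C" "(x, p (x, \<epsilon>), \<epsilon>) \<in> ?C"
    if "0 < \<epsilon>" "\<epsilon> \<le> e" "x \<in> cball x0 r" for \<epsilon> x
  proof -
    have n: "norm (p (x, \<epsilon>)) \<le> Rp" using Rp(2)[of "(x, \<epsilon>)"] that(3) \<epsilon>(2)[OF that(1,2)] by simp
    have "norm (h \<epsilon> x) \<le> norm (p (x, \<epsilon>)) + norm (h \<epsilon> x - p (x, \<epsilon>))"
      using norm_triangle_ineq[of "p (x, \<epsilon>)" "h \<epsilon> x - p (x, \<epsilon>)"] by simp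
    also have "\<dots> \<le> Rp + \<bar>B\<bar> * 1"
      using n \<epsilon>(3)[OF that(1,2)] that(1)
      by (intro add_mono order_trans[OF \<epsilon>(7)[OF that]] mult_left_mono power_le_one) auto
    finally show "(x, h \<epsilon> x, \<epsilon>) \<in> ?C" "(x, p (x, \<epsilon>), \<epsilon>) \<in> ?C"
      using n that(3) \<epsilon>(2)[OF that(1,2)] by (auto simp: R_def)
  qed
  have "\<exists>X. solves_ivp (\<lambda>x. f x (h \<epsilon> x) \<epsilon>) x0 t0 X \<and> (\<forall>t\<in>{0..t0}. X t \<in> cball x0 r)"
    if that: "0 < \<epsilon>" "\<epsilon> \<le> e" for \<epsilon>
  proof -
    have oK: "open K" by (rule K)
    have F: "smooth_on K (\<lambda>x. f x (h \<epsilon> x) \<epsilon>)"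
      by (rule smooth_on_cong[OF _ smooth_on_compose[OF f smooth_on_Pair[OF smooth_on_linear[OF oK bounded_linear_ident]
          smooth_on_Pair[OF h[OF \<epsilon>(1)[OF that]] smooth_on_const[OF oK, of \<epsilon>]]]]]) (use \<epsilon>(1)[OF that] in auto)
    obtain L where "L > 0" "\<And>x y. x \<in> cball x0 r \<Longrightarrow> y \<in> cball x0 r \<Longrightarrow>
        norm (f x (h \<epsilon> x) \<epsilon> - f y (h \<epsilon> y) \<epsilon>) \<le> L * norm (x - y)"
      using smooth_on_lipschitz[OF F compact_cball r(2) convex_cball] by blast
    then show ?thesis
      using M(2)[OF hR(1)[OF that]] t0 r M(1)
      by (intro bounded_field_ivp_exists[where M=M and L=L]) (auto simp: t0_def)
  qed
  then obtain X where X: "\<And>\<epsilon>. 0 < \<epsilon> \<Longrightarrow> \<epsilon> \<le> e \<Longrightarrow> solves_ivp (\<lambda>x. f x (h \<epsilon> x) \<epsilon>) x0 t0 (X \<epsilon>)"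
    "\<And>\<epsilon> t. 0 < \<epsilon> \<Longrightarrow> \<epsilon> \<le> e \<Longrightarrow> t \<in> {0..t0} \<Longrightarrow> X \<epsilon> t \<in> cball x0 r"
    by metis
  have sub: "cball x0 r \<times> {0..e} \<subseteq> ?\<Omega>" using r(2) \<epsilon>(1)[OF e] by auto
  have "\<exists>C\<ge>0. \<forall>\<epsilon>. 0 < \<epsilon> \<and> \<epsilon> \<le> e \<longrightarrow> (\<exists>a. \<forall>t\<in>{0..t0}.
      norm (p (X \<epsilon> t, \<epsilon>) - (\<Sum>j<N. t ^ j *\<^sub>R a j)) \<le> C * (t ^ N + \<epsilon> ^ N))"
  proof (rule approximate_flow_expansion[OF V sub _ _ X(2) _ p,
        where W = "\<lambda>\<epsilon> t. f (X \<epsilon> t) (h \<epsilon> (X \<epsilon> t)) \<epsilon>" and ?C0.0 = "Lf * \<bar>B\<bar>"])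
    fix \<epsilon> t assume *: "0 < \<epsilon>" "\<epsilon> \<le> e" "t \<in> {0..t0}"
    then show "(X \<epsilon> has_vector_derivative f (X \<epsilon> t) (h \<epsilon> (X \<epsilon> t)) \<epsilon>) (at t within {0..t0})"
      using X(1) by (simp add: solves_ivp_def)
    let ?x = "X \<epsilon> t"
    have x: "?x \<in> cball x0 r" using * by (rule X(2))
    have "norm (f ?x (h \<epsilon> ?x) \<epsilon> - f ?x (p (?x, \<epsilon>)) \<epsilon>) \<le> Lf * norm (h \<epsilon> ?x - p (?x, \<epsilon>))"
      using Lf(2)[OF hR[OF *(1,2) x]] by (simp add: norm_Pair)
    also have "\<dots> \<le> Lf * (\<bar>B\<bar> * \<epsilon> ^ N)" using Lf(1) \<epsilon>(7)[OF *(1,2) x] by (intro mult_left_mono) auto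
    finally show "norm (f ?x (h \<epsilon> ?x) \<epsilon> - V (?x, \<epsilon>)) \<le> Lf * \<bar>B\<bar> * \<epsilon> ^ N"
      by (simp add: V_def mult.assoc)
  qed (use t0 in auto)
  then obtain C where C: "C \<ge> 0" "\<And>\<epsilon>. 0 < \<epsilon> \<Longrightarrow> \<epsilon> \<le> e \<Longrightarrow> \<exists>a. \<forall>t\<in>{0..t0}.
      norm (p (X \<epsilon> t, \<epsilon>) - (\<Sum>j<N. t ^ j *\<^sub>R a j)) \<le> C * (t ^ N + \<epsilon> ^ N)" by blast
  define C' where "C' = 2 ^ N * (\<bar>B\<bar> + C * ((real N * c) ^ N + 1))"
  have "norm (forward_diff (\<phi> \<epsilon>) (\<tau> \<epsilon>) N (x0, h \<epsilon> x0)) \<le> C' * \<epsilon> ^ N"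
    if e': "0 < \<epsilon>" "\<epsilon> \<le> e" for \<epsilon>
  proof -
    note \<epsilon>' = \<epsilon>[OF e']
    obtain a where a: "\<And>t. t \<in> {0..t0} \<Longrightarrow>
        norm (p (X \<epsilon> t, \<epsilon>) - (\<Sum>j<N. t ^ j *\<^sub>R a j)) \<le> C * (t ^ N + \<epsilon> ^ N)"
      using C(2)[OF e'] by blast
    have XK: "X \<epsilon> t \<in> K" if "t \<in> {0..t0}" for t using X(2)[OF \<open>0 < \<epsilon>\<close> \<open>\<epsilon> \<le> e\<close> that] r(2) by blast
    have sol: "solves_ivp (fast_slow_field f g \<epsilon>) (x0, h \<epsilon> x0) t0 (\<lambda>t. (X \<epsilon> t, h \<epsilon> (X \<epsilon> t)))"
      using e' X(1)[OF e']
      by (intro fast_slow_manifold_solution[where K = K] h inv XK \<epsilon>'(1)) auto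
    have t: "real l * \<tau> \<epsilon> \<in> {0..t0}" "real l * \<tau> \<epsilon> \<le> real N * c * \<epsilon>" if "l \<le> N" for l
    proof -
      have "real l * \<tau> \<epsilon> \<le> real N * (c * \<epsilon>)"
        using that \<epsilon>'(5,6) by (intro mult_mono) auto
      then show "real l * \<tau> \<epsilon> \<in> {0..t0}" "real l * \<tau> \<epsilon> \<le> real N * c * \<epsilon>"
        using \<epsilon>'(4,5) by (auto simp: mult.assoc)
    qed
    let ?u = "\<lambda>l. h \<epsilon> (X \<epsilon> (real l * \<tau> \<epsilon>))" and ?P = "\<lambda>l. \<Sum>j<N. (real l * \<tau> \<epsilon>) ^ j *\<^sub>R a j"
    have "forward_diff (\<phi> \<epsilon>) (\<tau> \<epsilon>) N (x0, h \<epsilon> x0) = fdiff N ?u"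
      unfolding forward_diff_eq_fdiff
      by (intro fdiff_cong) (simp add: is_flowD[OF flow[OF \<epsilon>'(1)] sol t(1)])
    also have "\<dots> = fdiff N (\<lambda>l. ?u l - ?P l)" by (simp add: fdiff_diff fdiff_polynomial)
    also have "norm \<dots> \<le> 2 ^ N * ((\<bar>B\<bar> + C * ((real N * c) ^ N + 1)) * \<epsilon> ^ N)"
    proof (rule norm_fdiff_le)
      fix l assume l: "l \<le> N"
      let ?t = "real l * \<tau> \<epsilon>"
      have "norm (?u l - ?P l) \<le> norm (?u l - p (X \<epsilon> ?t, \<epsilon>)) + norm (p (X \<epsilon> ?t, \<epsilon>) - ?P l)"
        using norm_triangle_ineq[of "?u l - p (X \<epsilon> ?t, \<epsilon>)" "p (X \<epsilon> ?t, \<epsilon>) - ?P l"] by simp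
      also have "\<dots> \<le> \<bar>B\<bar> * \<epsilon> ^ N + C * (?t ^ N + \<epsilon> ^ N)"
        by (intro add_mono \<epsilon>'(7) a X(2) e' t(1) l)
      also have "\<dots> \<le> \<bar>B\<bar> * \<epsilon> ^ N + C * ((real N * c * \<epsilon>) ^ N + \<epsilon> ^ N)"
        using t[OF l] C(1) e' by (intro add_mono mult_left_mono power_mono) auto
      also have "\<dots> = (\<bar>B\<bar> + C * ((real N * c) ^ N + 1)) * \<epsilon> ^ N"
        by (simp add: algebra_simps power_mult_distrib)
      finally show "norm (?u l - ?P l) \<le> (\<bar>B\<bar> + C * ((real N * c) ^ N + 1)) * \<epsilon> ^ N" .
    qed
    finally show ?thesis by (simp add: C'_def mult.assoc)
  qed
  then show ?thesis
    using e by (intro exI[of _ C']) (auto simp: eventually_at_right_field intro!: exI[of _ e])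
qed

section \<open>Linearization of the forward difference in the fast variable\<close>

lemma fast_jacobian_eq_partial_derivative:
  fixes g :: "'a::euclidean_space \<Rightarrow> real^'n \<Rightarrow> real \<Rightarrow> real^'n"
  assumes g: "smooth_on S (\<lambda>(x, y, \<epsilon>). g x y \<epsilon>)" and S: "(x, y, 0) \<in> S"
  shows "fast_jacobian g x y *v w = frechet_derivative (\<lambda>(x, y, \<epsilon>). g x y \<epsilon>) (at (x, y, 0)) (0, w, 0)"
proof -
  let ?D = "frechet_derivative (\<lambda>(x, y, \<epsilon>). g x y \<epsilon>) (at (x, y, 0))"
  have "((\<lambda>y'. (x, y', 0::real)) has_derivative (\<lambda>w. (0, w, 0))) (at y)"
    by (intro has_derivative_Pair has_derivative_const has_derivative_ident)
  from has_derivative_compose[OF this smooth_onD(3)[OF g S]]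
  have d: "((\<lambda>y'. g x y' 0) has_derivative (\<lambda>w. ?D (0, w, 0))) (at y)" by simp
  then have "fast_jacobian g x y = matrix (\<lambda>w. ?D (0, w, 0))"
    unfolding fast_jacobian_def jacobian_def using frechet_derivative_at[OF d] by simp
  then show ?thesis
    using has_derivative_linear[OF d] by (simp add: matrix_works linear_matrix_vector_mul_eq)
qed

lemma linear_norm_funpow_ge:
  fixes Q :: "'a::real_normed_vector \<Rightarrow> 'a"
  assumes "0 \<le> k" "\<And>w. k * norm w \<le> norm (Q w)"
  shows "k ^ n * norm w \<le> norm ((Q ^^ n) w)"
proof (induction n)
  case (Suc n)
  have "k ^ Suc n * norm w \<le> k * norm ((Q ^^ n) w)"
    using mult_left_mono[OF Suc assms(1)] by (simp add: mult.assoc)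
  also have "\<dots> \<le> norm (Q ((Q ^^ n) w))" by (rule assms(2))
  finally show ?case by simp
qed simp

text \<open>
  Rescaled to fast time, the orbits are followed over an interval of length \<open>O(1)\<close>, and the field
  \<open>(\<epsilon> f, g)\<close> is close to linear. The comparison \<open>near_linear_flow_difference\<close> bounds the difference
  of two orbits up to \<open>\<delta>\<close>, and \<open>\<delta>\<close> is chosen so small that the error of the forward difference, whose
  coefficients have absolute sum \<open>2\<^sup>n\<close>, is half of the lower bound \<open>k\<close> for its linear part.
\<close>

lemma fast_forward_diff_near_linear:
  fixes f :: "'a::euclidean_space \<Rightarrow> real^'n \<Rightarrow> real \<Rightarrow> 'a"
    and g :: "'a \<Rightarrow> real^'n \<Rightarrow> real \<Rightarrow> real^'n"
  assumes \<epsilon>0: "0 < \<epsilon>0"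
    and f: "smooth_on (UNIV \<times> UNIV \<times> {-\<epsilon>0<..<\<epsilon>0}) (\<lambda>(x, y, \<epsilon>). f x y \<epsilon>)"
    and g: "smooth_on (UNIV \<times> UNIV \<times> {-\<epsilon>0<..<\<epsilon>0}) (\<lambda>(x, y, \<epsilon>). g x y \<epsilon>)"
    and eq: "g x0 ys 0 = 0"
    and hurwitz: "\<And>l. complex_eigenvalue (fast_jacobian g x0 ys) l \<Longrightarrow> Re l < 0"
    and flow: "\<And>\<epsilon>. \<epsilon> \<in> {0<..<\<epsilon>0} \<Longrightarrow> is_flow (fast_slow_field f g \<epsilon>) (\<phi> \<epsilon>)"
    and c: "0 < c1"
    and \<tau>: "\<forall>\<^sub>F \<epsilon> in at_right 0. c1 * \<epsilon> \<le> \<tau> \<epsilon> \<and> \<tau> \<epsilon> \<le> c2 * \<epsilon>"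
  shows "\<exists>r>0. \<exists>k>0. \<forall>\<^sub>F \<epsilon> in at_right 0. \<exists>M. linear M \<and> (\<forall>w. k * norm w \<le> norm (M w)) \<and>
    (\<forall>y\<in>cball ys r. flow_defined (fast_slow_field f g \<epsilon>) (x0, y) (real n * \<tau> \<epsilon>)) \<and>
    (\<forall>y\<in>cball ys r. \<forall>y'\<in>cball ys r.
      norm (forward_diff (\<phi> \<epsilon>) (\<tau> \<epsilon>) n (x0, y) - forward_diff (\<phi> \<epsilon>) (\<tau> \<epsilon>) n (x0, y') - M (y - y'))
        \<le> k / 2 * norm (y - y'))"
proof -
  have "\<forall>\<^sub>F \<epsilon> in at_right 0. 0 < \<epsilon> \<and> c1 * \<epsilon> \<le> c2 * \<epsilon>"
    using \<tau> eventually_at_right_less[of "0::real"] by eventually_elim (intro conjI; linarith)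
  then have "\<exists>\<epsilon>. 0 < \<epsilon> \<and> c1 * \<epsilon> \<le> c2 * \<epsilon>"
    by (rule eventually_happens'[rotated]) simp
  then have c12: "c1 \<le> c2" by auto
  \<comment> \<open>\<open>Suc n\<close> rather than \<open>n\<close>, so that \<open>T\<close> is positive and at least \<open>c2\<close> also for \<open>n = 0\<close>\<close>
  define T where "T = real (Suc n) * c2"
  have T: "0 < T" "c2 \<le> T" using c c12 by (auto simp: T_def algebra_simps intro!: add_pos_nonneg)
  let ?S = "UNIV \<times> UNIV \<times> {-\<epsilon>0<..<\<epsilon>0}"
  let ?f = "\<lambda>(x, y, \<epsilon>). f x y \<epsilon>" and ?g = "\<lambda>(x, y, \<epsilon>). g x y \<epsilon>"
  let ?z = "(x0, ys)" and ?p = "(x0, ys, 0::real)"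
  have pS: "?p \<in> ?S" using \<epsilon>0 by auto
  let ?A = "(*v) (fast_jacobian g x0 ys)"
  have linA: "linear ?A" by (rule bounded_linear.linear) simp
  have "\<exists>S. \<forall>w. solves_ivp ?A w T (S w)"
    using linear_ivp_exists[OF linA] T by (intro choice allI) auto
  then obtain S' where S': "\<And>w. solves_ivp ?A w T (S' w)" by blast
  define S where "S = (\<lambda>t w. S' w t)"
  have S: "solves_ivp ?A w T (\<lambda>t. S t w)" for w using S' by (simp add: S_def)
  have "w = 0" if "0 < s" "s \<le> T" "S s w = w" for s w
    by (rule hurwitz_no_periodic_orbit[OF hurwitz solves_ivp_subset[OF S that(2)] that(1,3)])
  then obtain k1 where k1: "k1 > 0" "\<And>s w. s \<in> {c1..c2} \<Longrightarrow> k1 * norm w \<le> norm (S s w - w)"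
    using linear_flow_minus_id_bounded_below[OF linA S _ c c12 T(2)] by blast
  define k where "k = k1 ^ n"
  have k: "k > 0" using k1 by (simp add: k_def)
  let ?Dg = "frechet_derivative ?g (at ?p)"
  have linDg: "linear ?Dg" using smooth_onD(3)[OF g pS] has_derivative_linear by blast
  define B where "B = (\<lambda>z::'a \<times> (real^'n). (0::'a, ?Dg (fst z, snd z, 0)))"
  have linB: "linear B"
    unfolding B_def
    by (intro linearI) (simp_all add: linear_add[OF linDg, symmetric] linear_cmul[OF linDg, symmetric])
  obtain N where N: "N > 0" "\<And>v. norm (B v) \<le> N * norm v" using linear_bounded_pos[OF linB] by blast
  define \<delta> where "\<delta> = min 1 (k / 2 / (2 ^ n * (T * exp (2 * (N + 1) * T))))"
  have \<delta>: "\<delta> > 0" "\<delta> \<le> 1" using k T(1) by (auto simp: \<delta>_def)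
  have \<delta>k: "2 ^ n * (\<delta> * T * exp (2 * (N + 1) * T)) \<le> k / 2"
  proof -
    have pos: "0 < 2 ^ n * (T * exp (2 * (N + 1) * T))" using T(1) by simp
    have "\<delta> \<le> k / 2 / (2 ^ n * (T * exp (2 * (N + 1) * T)))" by (simp add: \<delta>_def)
    then have "\<delta> * (2 ^ n * (T * exp (2 * (N + 1) * T))) \<le> k / 2"
      by (simp only: pos_le_divide_eq[OF pos])
    then show ?thesis by (simp only: mult_ac)
  qed
  obtain r1 where r1: "r1 > 0" "cball ?p r1 \<subseteq> ?S"
    "\<And>u v. u \<in> cball ?p r1 \<Longrightarrow> v \<in> cball ?p r1 \<Longrightarrow> norm (?g u - ?g v - ?Dg (u - v)) \<le> \<delta> / 2 * norm (u - v)"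
    using smooth_on_strictly_differentiable[OF g pS, of "\<delta> / 2"] \<delta> by (metis half_gt_zero)
  obtain Lf where Lf: "Lf > 0" "\<And>u v. u \<in> cball ?p r1 \<Longrightarrow> v \<in> cball ?p r1 \<Longrightarrow>
      norm (?f u - ?f v) \<le> Lf * norm (u - v)"
    using smooth_on_lipschitz[OF f compact_cball r1(2) convex_cball] by blast
  define \<rho> where "\<rho> = r1 / 2"
  have \<rho>: "\<rho> > 0" using r1 by (simp add: \<rho>_def)
  have in_ball: "(fst z, snd z, \<epsilon>) \<in> cball ?p r1" if "z \<in> cball ?z \<rho>" "0 < \<epsilon>" "\<epsilon> \<le> \<rho>" for z \<epsilon>
  proof -
    have "norm ((fst z, snd z, \<epsilon>) - ?p) \<le> norm (((fst z, snd z) - ?z)) + norm \<epsilon>"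
    proof -
      have "(fst z, snd z, \<epsilon>) - ?p = (fst z - x0, snd z - ys, 0) + (0, 0, \<epsilon>)" by simp
      then have "norm ((fst z, snd z, \<epsilon>) - ?p) \<le> norm (fst z - x0, snd z - ys, 0::real) + norm (0::'a, 0::real^'n, \<epsilon>)"
        by (metis norm_triangle_ineq)
      then show ?thesis by (cases z) (simp add: norm_Pair)
    qed
    also have "\<dots> \<le> \<rho> + \<rho>" using that by (intro add_mono) (auto simp: dist_norm norm_minus_commute)
    finally have "dist (fst z, snd z, \<epsilon>) ?p \<le> r1" by (simp only: dist_norm \<rho>_def field_sum_of_halves)
    then show ?thesis by (simp only: mem_cball dist_commute)
  qed
  define G where "G = (\<lambda>\<epsilon> z. (\<epsilon> *\<^sub>R f (fst z) (snd z) \<epsilon>, g (fst z) (snd z) \<epsilon>))"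
  have GB: "norm (G \<epsilon> u - G \<epsilon> v - B (u - v)) \<le> \<delta> * norm (u - v)"
    if "0 < \<epsilon>" "\<epsilon> \<le> \<rho>" "\<epsilon> * Lf \<le> \<delta> / 2" "u \<in> cball ?z \<rho>" "v \<in> cball ?z \<rho>" for \<epsilon> u v
  proof -
    let ?u = "(fst u, snd u, \<epsilon>)" and ?v = "(fst v, snd v, \<epsilon>)"
    note b = in_ball[OF that(4,1,2)] in_ball[OF that(5,1,2)]
    have d: "?u - ?v = (fst (u - v), snd (u - v), 0)" by simp
    have n: "norm (?u - ?v) = norm (u - v)" unfolding d by (cases "u - v") (simp add: norm_Pair)
    have "G \<epsilon> u - G \<epsilon> v - B (u - v) = (\<epsilon> *\<^sub>R (?f ?u - ?f ?v), ?g ?u - ?g ?v - ?Dg (?u - ?v))"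
      unfolding d by (simp add: G_def B_def scaleR_diff_right)
    then have "norm (G \<epsilon> u - G \<epsilon> v - B (u - v))
        \<le> norm (\<epsilon> *\<^sub>R (?f ?u - ?f ?v)) + norm (?g ?u - ?g ?v - ?Dg (?u - ?v))"
      by (simp only: norm_Pair_le)
    also have "\<dots> \<le> \<epsilon> * (Lf * norm (?u - ?v)) + \<delta> / 2 * norm (?u - ?v)"
    proof (rule add_mono)
      show "norm (\<epsilon> *\<^sub>R (?f ?u - ?f ?v)) \<le> \<epsilon> * (Lf * norm (?u - ?v))"
        using mult_left_mono[OF Lf(2)[OF b], of \<epsilon>] that(1) by simp
    qed (rule r1(3)[OF b])
    also have "\<dots> = (\<epsilon> * Lf + \<delta> / 2) * norm (u - v)" unfolding n by (simp add: algebra_simps)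
    also have "\<dots> \<le> \<delta> * norm (u - v)" using that(3) by (intro mult_right_mono) auto
    finally show ?thesis .
  qed
  define E where "E = exp ((N + 1) * T)"
  have E: "E > 0" by (simp add: E_def)
  \<comment> \<open>orbits that start within \<open>r\<close> of \<open>ys\<close> stay within \<open>\<rho>\<close> up to time \<open>T\<close>\<close>
  define r where "r = \<rho> / 2 / E"
  have r: "r > 0" using \<rho> E by (simp add: r_def)
  have Glim: "((\<lambda>\<epsilon>. norm (G \<epsilon> ?z) * T * E) \<longlongrightarrow> 0) (at_right 0)"
  proof -
    have lim: "((\<lambda>\<epsilon>. F (x0, ys, \<epsilon>)) \<longlongrightarrow> F (x0, ys, 0)) (at_right 0)"
      if "smooth_on ?S F" for F :: "'a \<times> (real^'n) \<times> real \<Rightarrow> 'c::real_normed_vector"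
    proof -
      have "isCont F ?p"
        using smooth_onD(1,2)[OF that] pS by (simp add: continuous_on_eq_continuous_at)
      then show ?thesis
        by (rule isCont_tendsto_compose) (auto intro!: tendsto_intros)
    qed
    have "((\<lambda>\<epsilon>. norm (G \<epsilon> ?z) * T * E) \<longlongrightarrow> norm (0 *\<^sub>R f x0 ys 0, g x0 ys 0) * T * E) (at_right 0)"
      unfolding G_def fst_conv snd_conv using lim[OF f, unfolded prod.case] lim[OF g, unfolded prod.case]
      by (intro tendsto_mult tendsto_norm tendsto_Pair tendsto_scaleR tendsto_const tendsto_ident_at)
    then show ?thesis by (simp add: eq)
  qed
  have "\<forall>\<^sub>F \<epsilon> in at_right 0. norm (G \<epsilon> ?z) * T * E < \<rho> / 2"
    using Glim \<rho> by (intro order_tendstoD(2)[OF Glim]) auto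
  moreover have "\<forall>\<^sub>F \<epsilon> in at_right 0. \<epsilon> < min \<rho> (min \<epsilon>0 (\<delta> / 2 / Lf))"
    using \<rho> \<epsilon>0 \<delta> Lf(1) by (intro order_tendstoD(2)[OF tendsto_ident_at]) auto
  ultimately have "\<forall>\<^sub>F \<epsilon> in at_right 0. \<exists>M. linear M \<and> (\<forall>w. k * norm w \<le> norm (M w)) \<and>
    (\<forall>y\<in>cball ys r. flow_defined (fast_slow_field f g \<epsilon>) (x0, y) (real n * \<tau> \<epsilon>)) \<and>
    (\<forall>y\<in>cball ys r. \<forall>y'\<in>cball ys r.
      norm (forward_diff (\<phi> \<epsilon>) (\<tau> \<epsilon>) n (x0, y) - forward_diff (\<phi> \<epsilon>) (\<tau> \<epsilon>) n (x0, y') - M (y - y'))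
        \<le> k / 2 * norm (y - y'))"
    using \<tau> eventually_at_right_less[of 0]
  proof eventually_elim
    case (elim \<epsilon>)
    then have \<epsilon>: "0 < \<epsilon>" "\<epsilon> \<le> \<rho>" "\<epsilon> \<in> {0<..<\<epsilon>0}" "norm (G \<epsilon> ?z) * T * E \<le> \<rho> / 2"
      "c1 * \<epsilon> \<le> \<tau> \<epsilon>" "\<tau> \<epsilon> \<le> c2 * \<epsilon>" by auto
    have \<epsilon>L: "\<epsilon> * Lf \<le> \<delta> / 2"
      using elim Lf(1) by (auto simp: pos_less_divide_eq intro: less_imp_le)
    define s where "s = \<tau> \<epsilon> / \<epsilon>"
    have s: "s \<in> {c1..c2}" "\<tau> \<epsilon> = \<epsilon> * s" using \<epsilon> by (auto simp: s_def field_simps)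
    have s0: "0 \<le> s" using s c by auto
    have ls: "real l * s \<in> {0..T}" if "l \<le> n" for l
    proof -
      have "real l * s \<le> real (Suc n) * c2" using that s s0 by (intro mult_mono) auto
      then show ?thesis using s0 by (simp add: T_def)
    qed
    note GB' = GB[OF \<epsilon>(1,2) \<epsilon>L]
    have "\<exists>Z. solves_ivp (G \<epsilon>) (x0, y) T Z \<and> (\<forall>t\<in>{0..T}. Z t \<in> cball ?z \<rho>)"
      if y: "y \<in> cball ys r" for y
    proof (rule near_linear_ivp_exists[OF linB N(2) _ _ GB'])
      have "norm ((x0, y) - ?z) = norm (y - ys)" by (simp add: norm_Pair)
      also have "\<dots> \<le> r" using y by (simp add: dist_norm norm_minus_commute)
      finally have "norm ((x0, y) - ?z) * E \<le> r * E" using E by (intro mult_right_mono) auto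
      then show "norm ((x0, y) - ?z) * exp ((N + 1) * T) \<le> \<rho> / 2" using E by (simp add: r_def E_def[symmetric])
    qed (use N T \<delta> \<rho> \<epsilon>(4) E_def in auto)
    then obtain Z where Z: "\<And>y. y \<in> cball ys r \<Longrightarrow> solves_ivp (G \<epsilon>) (x0, y) T (Z y)"
      "\<And>y t. y \<in> cball ys r \<Longrightarrow> t \<in> {0..T} \<Longrightarrow> Z y t \<in> cball ?z \<rho>"
      by metis
    have sol: "solves_ivp (fast_slow_field f g \<epsilon>) (x0, y) (\<epsilon> * T) (\<lambda>t. Z y (t / \<epsilon>))"
      if "y \<in> cball ys r" for y
      by (rule solves_ivp_rescale[OF Z(1)[OF that] \<epsilon>(1)])
        (use \<epsilon>(1) in \<open>auto simp: G_def fast_slow_field_def split: prod.splits\<close>)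
    define M where "M = (\<lambda>w. fdiff n (\<lambda>l. S (real l * s) w))"
    have linS: "linear (S t)" if "t \<in> {0..T}" for t by (rule linear_flow_linear[OF linA S that])
    have linM: "linear M"
    proof (rule linearI)
      fix v w a
      have "M (v + w) = fdiff n (\<lambda>l. S (real l * s) v + S (real l * s) w)"
        unfolding M_def by (intro fdiff_cong linear_add linS ls)
      then show "M (v + w) = M v + M w" by (simp add: fdiff_add M_def)
      have "M (a *\<^sub>R v) = fdiff n (\<lambda>l. a *\<^sub>R S (real l * s) v)"
        unfolding M_def by (intro fdiff_cong linear_cmul linS ls)
      also have "\<dots> = a *\<^sub>R M v" unfolding M_def by (rule fdiff_linear) (simp add: linear_scale_self)
      finally show "M (a *\<^sub>R v) = a *\<^sub>R M v" .
    qed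
    have "k * norm w \<le> norm (M w)" for w
    proof -
      have sT: "s \<in> {0..T}" using s s0 T by auto
      have "M w = fdiff n (\<lambda>l. (S s ^^ l) w)"
        unfolding M_def using ls s0 by (intro fdiff_cong linear_flow_funpow[OF linA S]) auto
      also have "\<dots> = ((\<lambda>v. S s v - v) ^^ n) w" by (rule fdiff_funpow[OF linS[OF sT]])
      finally show ?thesis
        unfolding k_def using linear_norm_funpow_ge[of k1 "\<lambda>v. S s v - v" n w] k1 s(1) by simp
    qed
    moreover have "flow_defined (fast_slow_field f g \<epsilon>) (x0, y) (real n * \<tau> \<epsilon>)" if y: "y \<in> cball ys r" for y
    proof -
      have "real n * \<tau> \<epsilon> \<le> \<epsilon> * T" using ls[of n] \<epsilon>(1) by (simp add: s(2) mult.left_commute)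
      moreover have "0 \<le> real n * \<tau> \<epsilon>" using s0 \<epsilon>(1) by (simp add: s(2))
      ultimately show ?thesis unfolding flow_defined_def using solves_ivp_subset[OF sol[OF y]] by blast
    qed
    moreover have "norm (forward_diff (\<phi> \<epsilon>) (\<tau> \<epsilon>) n (x0, y) - forward_diff (\<phi> \<epsilon>) (\<tau> \<epsilon>) n (x0, y') - M (y - y'))
        \<le> k / 2 * norm (y - y')" if y: "y \<in> cball ys r" "y' \<in> cball ys r" for y y'
    proof -
      have D: "forward_diff (\<phi> \<epsilon>) (\<tau> \<epsilon>) n (x0, y) = fdiff n (\<lambda>l. snd (Z y (real l * s)))"
        if "y \<in> cball ys r" for y
        unfolding forward_diff_eq_fdiff
      proof (rule fdiff_cong)
        fix l assume "l \<le> n"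
        then have "real l * \<tau> \<epsilon> \<in> {0..\<epsilon> * T}" "real l * \<tau> \<epsilon> / \<epsilon> = real l * s"
          using ls[of l] \<epsilon>(1) by (auto simp: s(2) mult.left_commute)
        then show "snd (\<phi> \<epsilon> (x0, y) (real l * \<tau> \<epsilon>)) = snd (Z y (real l * s))"
          using is_flowD[OF flow[OF \<epsilon>(3)] sol[OF that]] by simp
      qed
      \<comment> \<open>\<open>B\<close> leaves the slow variable fixed, and on differences with vanishing slow part it acts as \<open>A\<close>\<close>
      have Y: "solves_ivp B ((x0, y) - (x0, y')) T (\<lambda>t. (0, S t (y - y')))"
      proof -
        have "B (0, w) = (0, ?A w)" for w
          by (simp add: B_def fast_jacobian_eq_partial_derivative[OF g pS])
        then show ?thesis
          using S[of "y - y'"] by (auto simp: solves_ivp_def intro!: has_vector_derivative_Pair)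
      qed
      have "forward_diff (\<phi> \<epsilon>) (\<tau> \<epsilon>) n (x0, y) - forward_diff (\<phi> \<epsilon>) (\<tau> \<epsilon>) n (x0, y') - M (y - y')
          = fdiff n (\<lambda>l. snd (Z y (real l * s)) - snd (Z y' (real l * s)) - S (real l * s) (y - y'))"
        by (simp only: D[OF y(1)] D[OF y(2)] M_def fdiff_diff)
      also have "norm \<dots> \<le> 2 ^ n * (\<delta> * T * exp (2 * (N + 1) * T) * norm (y - y'))"
      proof (rule norm_fdiff_le)
        fix l assume "l \<le> n"
        let ?t = "real l * s"
        have "norm (Z y ?t - Z y' ?t - (0, S ?t (y - y')))
            \<le> \<delta> * T * exp (2 * (N + 1) * T) * norm ((x0, y) - (x0, y'))"
          using N(1) T(1) \<delta>
          by (intro near_linear_flow_difference[OF linB N(2) _ _ GB' _ _ Z(1)[OF y(1)] Z(2)[OF y(1)]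
                Z(1)[OF y(2)] Z(2)[OF y(2)] Y ls[OF \<open>l \<le> n\<close>]]) auto
        moreover have "norm (snd (Z y ?t - Z y' ?t - (0, S ?t (y - y'))))
            \<le> norm (Z y ?t - Z y' ?t - (0, S ?t (y - y')))"
          by (metis norm_snd_le prod.collapse)
        ultimately show "norm (snd (Z y ?t) - snd (Z y' ?t) - S ?t (y - y'))
            \<le> \<delta> * T * exp (2 * (N + 1) * T) * norm (y - y')" by (simp add: norm_Pair)
      qed
      also have "\<dots> = 2 ^ n * (\<delta> * T * exp (2 * (N + 1) * T)) * norm (y - y')" by simp
      also have "\<dots> \<le> k / 2 * norm (y - y')" using \<delta>k by (intro mult_right_mono) auto
      finally show ?thesis .
    qed
    ultimately show ?case using linM by blast
  qed
  then show ?thesis using r k by blast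
qed

section \<open>The fixed point\<close>

text \<open>
  The simplified Newton map \<open>y - M\<^sup>-\<^sup>1 (D y)\<close> contracts by the factor 1/2, and the bound on \<open>D c\<close>
  keeps it inside the ball.
\<close>

lemma unique_zero_near_linear:
  fixes D M :: "'a::euclidean_space \<Rightarrow> 'a"
  assumes M: "linear M" and k: "0 < k" "\<And>w. k * norm w \<le> norm (M w)"
    and D: "\<And>y y'. y \<in> cball c r \<Longrightarrow> y' \<in> cball c r \<Longrightarrow>
      norm (D y - D y' - M (y - y')) \<le> k / 2 * norm (y - y')"
    and c: "norm (D c) \<le> k * r / 2"
  shows "\<exists>y\<in>cball c r. D y = 0 \<and> norm (y - c) \<le> 2 / k * norm (D c) \<and>
    (\<forall>y'\<in>cball c r. D y' = 0 \<longrightarrow> y' = y)"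
proof -
  have "inj M"
    unfolding linear_injective_0[OF M] using k by (metis mult_le_0_iff norm_le_zero_iff norm_zero not_le)
  then obtain N where N: "linear N" "\<And>v. M (N v) = v" "\<And>v. N (M v) = v"
    using linear_injective_isomorphism[OF M] by blast
  have nN: "norm (N v) \<le> norm v / k" for v
    using k(1) k(2)[of "N v"] N(2)[of v] by (simp add: field_simps)
  have r: "0 \<le> r" using order_trans[OF norm_ge_zero c] k(1) by (simp add: zero_le_mult_iff)
  define P where "P = (\<lambda>y. y - N (D y))"
  have PP: "norm (P y - P y') \<le> 1 / 2 * norm (y - y')" if "y \<in> cball c r" "y' \<in> cball c r" for y y'
  proof -
    have "P y - P y' = - N (D y - D y' - M (y - y'))"
      by (simp add: P_def linear_diff[OF N(1)] N(3))
    then have "norm (P y - P y') \<le> norm (D y - D y' - M (y - y')) / k" using nN by simp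
    also have "\<dots> \<le> (k / 2 * norm (y - y')) / k" using D[OF that] k(1) by (intro divide_right_mono) auto
    finally show ?thesis using k(1) by simp
  qed
  have zero: "D y = 0 \<longleftrightarrow> P y = y" for y
    using N(2)[of "D y"] linear_0[OF M] linear_0[OF N(1)] by (auto simp: P_def)
  have "\<exists>!y\<in>cball c r. P y = y"
  proof (rule Banach_fix[of _ "1/2"])
    show "P ` cball c r \<subseteq> cball c r"
    proof safe
      fix y assume y: "y \<in> cball c r"
      have "norm (P y - c) \<le> norm (P y - P c) + norm (P c - c)"
        using norm_triangle_ineq[of "P y - P c" "P c - c"] by simp
      moreover have "norm (P y - P c) \<le> 1 / 2 * r"
        using PP[OF y, of c] y r by (auto simp: dist_norm norm_minus_commute)
      moreover have "norm (P c - c) \<le> r / 2"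
      proof -
        have "norm (P c - c) \<le> norm (D c) / k" using nN by (simp add: P_def)
        also have "\<dots> \<le> (k * r / 2) / k" using c k(1) by (intro divide_right_mono) auto
        finally show ?thesis using k(1) by simp
      qed
      ultimately show "P y \<in> cball c r" by (simp add: dist_norm norm_minus_commute)
    qed
    show "dist (P x) (P y) \<le> 1 / 2 * dist x y" if "x \<in> cball c r" "y \<in> cball c r" for x y
      using PP[OF that] by (simp add: dist_norm)
  qed (use r in \<open>auto simp: complete_eq_closed\<close>)
  then obtain y where y: "y \<in> cball c r" "P y = y" and u: "\<And>y'. y' \<in> cball c r \<Longrightarrow> P y' = y' \<Longrightarrow> y' = y"
    by blast
  have "norm (y - c) \<le> norm (P y - P c) + norm (P c - c)"
    using norm_triangle_ineq[of "P y - P c" "P c - c"] y by simp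
  also have "\<dots> \<le> 1 / 2 * norm (y - c) + norm (D c) / k"
    using PP[OF y(1), of c] r nN[of "D c"] by (intro add_mono) (auto simp: P_def)
  finally have "norm (y - c) \<le> 2 / k * norm (D c)" by simp
  moreover have "D y = 0" using y(2) by (simp only: zero)
  moreover have "\<forall>y'\<in>cball c r. D y' = 0 \<longrightarrow> y' = y" unfolding zero using u by blast
  ultimately show ?thesis using y(1) by blast
qed
theorem mainTheorem4:
  fixes f :: "real^'ns \<Rightarrow> real^'nf \<Rightarrow> real \<Rightarrow> real^'ns"
    and g :: "real^'ns \<Rightarrow> real^'nf \<Rightarrow> real \<Rightarrow> real^'nf"
    and \<epsilon>0 :: real
    and K :: "(real^'ns) set"
    and h :: "real \<Rightarrow> real^'ns \<Rightarrow> real^'nf"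
    and hc :: "nat \<Rightarrow> real^'ns \<Rightarrow> real^'nf"
    and \<phi> :: "real \<Rightarrow> (real^'ns) \<times> (real^'nf) \<Rightarrow> real \<Rightarrow> (real^'ns) \<times> (real^'nf)"
    and H Hh :: "real \<Rightarrow> real"
    and x0 :: "real^'ns"
    and m :: nat
    and hm :: "real \<Rightarrow> real^'nf"
  assumes "0 < \<epsilon>0"
    and "smooth_on (UNIV \<times> UNIV \<times> {-\<epsilon>0<..<\<epsilon>0}) (\<lambda>(x, y, \<epsilon>). f x y \<epsilon>)"
    and "smooth_on (UNIV \<times> UNIV \<times> {-\<epsilon>0<..<\<epsilon>0}) (\<lambda>(x, y, \<epsilon>). g x y \<epsilon>)"
    and "\<forall>x y. g x y 0 = 0 \<longrightarrow> det (fast_jacobian g x y) \<noteq> 0"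
    \<comment> \<open>the slow manifold, the graph of \<open>h \<epsilon>\<close> over \<open>K\<close>\<close>
    and "open K"
    and "\<forall>\<epsilon>\<in>{0<..<\<epsilon>0}. smooth_on K (h \<epsilon>)"
    and "\<forall>\<epsilon>\<in>{0<..<\<epsilon>0}. \<forall>x\<in>K.
           g x (h \<epsilon> x) \<epsilon> - \<epsilon> *\<^sub>R frechet_derivative (h \<epsilon>) (at x) (f x (h \<epsilon> x) \<epsilon>) = 0"
    \<comment> \<open>the asymptotic expansion of \<open>h\<close>, locally uniformly on \<open>K\<close>\<close>
    and "\<forall>i. smooth_on K (hc i)"
    and "\<forall>N C. compact C \<and> C \<subseteq> K \<longrightarrow>
           (\<exists>B. \<forall>\<^sub>F \<epsilon> in at_right 0. \<forall>x\<in>C.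
              norm (h \<epsilon> x - (\<Sum>i<N. \<epsilon> ^ i *\<^sub>R hc i x)) \<le> B * \<epsilon> ^ N)"
    and "\<forall>x\<in>K. g x (hc 0 x) 0 = 0"
    \<comment> \<open>normal attractivity\<close>
    and "\<exists>\<mu>>0. \<forall>x\<in>K. \<forall>l. complex_eigenvalue (fast_jacobian g x (hc 0 x)) l \<longrightarrow> Re l \<le> - \<mu>"
    and "\<forall>\<epsilon>\<in>{0<..<\<epsilon>0}. is_flow (fast_slow_field f g \<epsilon>) (\<phi> \<epsilon>)"
    and "\<forall>\<epsilon>\<in>{0<..<\<epsilon>0}. 0 < H \<epsilon> \<and> 0 < Hh \<epsilon>"
    and "H \<in> \<Theta>[at_right 0](\<lambda>\<epsilon>. \<epsilon>)" and "Hh \<in> \<Theta>[at_right 0](\<lambda>\<epsilon>. \<epsilon>)"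
    and "x0 \<in> K"
    and "\<forall>\<^sub>F \<epsilon> in at_right 0. hm \<epsilon> isolated_in {y. y_time_deriv (\<phi> \<epsilon>) (m + 1) (x0, y) = 0}"
    and "(\<lambda>\<epsilon>. norm (hm \<epsilon> - h \<epsilon> x0)) \<in> O[at_right 0](\<lambda>\<epsilon>. \<epsilon> ^ (m + 1))"
  shows "\<exists>hhat :: real \<Rightarrow> real^'nf.
      (\<forall>\<^sub>F \<epsilon> in at_right 0.
         flow_defined (fast_slow_field f g \<epsilon>) (x0, hhat \<epsilon>) (real (m + 1) * Hh \<epsilon>) \<and>
         hhat \<epsilon> isolated_in {y. Fhat (\<phi> \<epsilon>) (H \<epsilon> / Hh \<epsilon>) (Hh \<epsilon>) m x0 y = y}) \<and>
      (\<lambda>\<epsilon>. norm (hhat \<epsilon> - hm \<epsilon>)) \<in> O[at_right 0](\<lambda>\<epsilon>. \<epsilon> ^ (m + 1)) \<and>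
      (\<lambda>\<epsilon>. norm (hhat \<epsilon> - h \<epsilon> x0)) \<in> O[at_right 0](\<lambda>\<epsilon>. \<epsilon> ^ (m + 1))"
proof -
  note \<epsilon>0 = assms(1) and f = assms(2) and g = assms(3) and Kopen = assms(5)
    and hsmooth = assms(6) and inv = assms(7) and hcs = assms(8) and expansion = assms(9)
    and flow = assms(12) and pos = assms(13) and x0 = assms(16) and hm = assms(18)
  let ?n = "m + 1" and ?ys = "hc 0 x0"
  let ?D = "\<lambda>\<epsilon> y. forward_diff (\<phi> \<epsilon>) (Hh \<epsilon>) ?n (x0, y)"
  have hurwitz: "Re l < 0" if "complex_eigenvalue (fast_jacobian g x0 ?ys) l" for l
    using assms(11) x0 that by force
  have small: "\<forall>\<^sub>F \<epsilon> in at_right 0. \<epsilon> \<in> {0<..<\<epsilon>0}"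
    using eventually_at_right_real[OF \<epsilon>0] .
  then have Hpos: "\<forall>\<^sub>F \<epsilon> in at_right 0. 0 < \<epsilon> \<and> 0 < H \<epsilon> \<and> 0 < Hh \<epsilon>"
    using pos by (auto elim: eventually_mono)
  obtain c2 where c2: "\<forall>\<^sub>F \<epsilon> in at_right 0. norm (Hh \<epsilon>) \<le> c2 * norm \<epsilon>"
    using bigthetaD1[OF assms(15)] by (elim landau_o.bigE)
  obtain c1 where c1: "c1 > 0" "\<forall>\<^sub>F \<epsilon> in at_right 0. norm (Hh \<epsilon>) \<ge> c1 * norm \<epsilon>"
    using bigthetaD2[OF assms(15)] by (elim landau_omega.bigE)
  have \<tau>: "\<forall>\<^sub>F \<epsilon> in at_right 0. c1 * \<epsilon> \<le> Hh \<epsilon> \<and> Hh \<epsilon> \<le> c2 * \<epsilon>"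
    using c1(2) c2 Hpos by eventually_elim auto
  have \<tau>': "\<forall>\<^sub>F \<epsilon> in at_right 0. 0 \<le> Hh \<epsilon> \<and> Hh \<epsilon> \<le> c2 * \<epsilon>"
    using \<tau> Hpos by eventually_elim auto
  obtain C where C: "\<forall>\<^sub>F \<epsilon> in at_right 0. norm (?D \<epsilon> (h \<epsilon> x0)) \<le> C * \<epsilon> ^ ?n"
    using slow_manifold_forward_diff[where h = h and g = g and hc = hc and N = "m + 1" and \<phi> = \<phi>,
        OF \<epsilon>0 f Kopen x0 _ _ _ _ _ \<tau>']
      hsmooth inv hcs expansion flow by blast
  obtain r k where r: "r > 0" and k: "k > 0" and lin: "\<forall>\<^sub>F \<epsilon> in at_right 0. \<exists>M. linear M \<and>
      (\<forall>w. k * norm w \<le> norm (M w)) \<and>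
      (\<forall>y\<in>cball ?ys r. flow_defined (fast_slow_field f g \<epsilon>) (x0, y) (real ?n * Hh \<epsilon>)) \<and>
      (\<forall>y\<in>cball ?ys r. \<forall>y'\<in>cball ?ys r.
        norm (?D \<epsilon> y - ?D \<epsilon> y' - M (y - y')) \<le> k / 2 * norm (y - y'))"
    using fast_forward_diff_near_linear[where \<phi> = \<phi> and n = "m + 1", OF \<epsilon>0 f g _ hurwitz _ c1(1) \<tau>] assms(10) x0 flow
    by blast
  obtain B where B: "\<forall>\<^sub>F \<epsilon> in at_right 0. norm (h \<epsilon> x0 - ?ys) \<le> B * \<epsilon>"
    using expansion[rule_format, of "{x0}" 1] x0 by auto
  define C' where "C' = 2 / k * C"
  \<comment> \<open>for small \<open>\<epsilon>\<close> the Newton ball around \<open>h \<epsilon> x0\<close> lies inside \<open>cball (hc 0 x0) r\<close>, the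
    residual is small enough, and the zero lies in the open ball, hence is isolated\<close>
  have zero_lim: "((\<lambda>\<epsilon>. c * \<epsilon> ^ Suc j) \<longlongrightarrow> 0) (at_right 0)" for c :: real and j
    by (auto intro!: tendsto_eq_intros)
  have "\<forall>\<^sub>F \<epsilon> in at_right 0. B * \<epsilon> < r / 2"
    using r zero_lim[of B 0] by (intro order_tendstoD(2)) auto
  moreover have "\<forall>\<^sub>F \<epsilon> in at_right 0. C * \<epsilon> ^ ?n < k * (r / 2) / 2"
    using r k zero_lim[of C m] by (intro order_tendstoD(2)) auto
  moreover have "\<forall>\<^sub>F \<epsilon> in at_right 0. C' * \<epsilon> ^ ?n < r / 2"
    using r zero_lim[of C' m] by (intro order_tendstoD(2)) auto
  ultimately have "\<forall>\<^sub>F \<epsilon> in at_right 0. \<exists>y.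
      flow_defined (fast_slow_field f g \<epsilon>) (x0, y) (real ?n * Hh \<epsilon>) \<and>
      y isolated_in {y. Fhat (\<phi> \<epsilon>) (H \<epsilon> / Hh \<epsilon>) (Hh \<epsilon>) m x0 y = y} \<and>
      norm (y - h \<epsilon> x0) \<le> C' * \<epsilon> ^ ?n"
    using C lin B Hpos
  proof eventually_elim
    case (elim \<epsilon>)
    then obtain M where M: "linear M" "\<And>w. k * norm w \<le> norm (M w)"
      "\<And>y. y \<in> cball ?ys r \<Longrightarrow> flow_defined (fast_slow_field f g \<epsilon>) (x0, y) (real ?n * Hh \<epsilon>)"
      "\<And>y y'. y \<in> cball ?ys r \<Longrightarrow> y' \<in> cball ?ys r \<Longrightarrow>
        norm (?D \<epsilon> y - ?D \<epsilon> y' - M (y - y')) \<le> k / 2 * norm (y - y')" by blast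
    let ?c = "h \<epsilon> x0"
    have sub: "cball ?c (r / 2) \<subseteq> cball ?ys r"
    proof
      fix y assume "y \<in> cball ?c (r / 2)"
      moreover have "dist ?ys ?c \<le> r / 2" using elim by (simp add: dist_norm norm_minus_commute)
      ultimately show "y \<in> cball ?ys r" using dist_triangle[of ?ys y ?c] by simp
    qed
    have "norm (?D \<epsilon> ?c) \<le> k * (r / 2) / 2" using elim by linarith
    then obtain y where y: "y \<in> cball ?c (r / 2)" "?D \<epsilon> y = 0"
      "norm (y - ?c) \<le> 2 / k * norm (?D \<epsilon> ?c)"
      "\<And>y'. y' \<in> cball ?c (r / 2) \<Longrightarrow> ?D \<epsilon> y' = 0 \<Longrightarrow> y' = y"
      using unique_zero_near_linear[OF M(1) k M(2), of ?c "r / 2" "?D \<epsilon>"] M(4) sub by blast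
    have "2 / k * norm (?D \<epsilon> ?c) \<le> 2 / k * (C * \<epsilon> ^ ?n)"
      using elim k by (intro mult_left_mono) auto
    then have yC: "norm (y - ?c) \<le> C' * \<epsilon> ^ ?n" using y(3) by (simp add: C'_def)
    have \<eta>: "H \<epsilon> / Hh \<epsilon> \<noteq> 0" using elim by simp
    have zeros: "{y. Fhat (\<phi> \<epsilon>) (H \<epsilon> / Hh \<epsilon>) (Hh \<epsilon>) m x0 y = y} = {y. ?D \<epsilon> y = 0}"
      using \<eta> by (auto simp: Fhat_def)
    have "y isolated_in {y. ?D \<epsilon> y = 0}"
      unfolding isolated_in_def
    proof (intro conjI exI)
      show "open (ball ?c (r / 2))" by simp
      have "y \<in> ball ?c (r / 2)" using yC elim by (simp add: dist_norm norm_minus_commute)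
      then show "ball ?c (r / 2) \<inter> {y. ?D \<epsilon> y = 0} = {y}" using y(2,4) by auto
    qed (use y(2) in simp)
    moreover have "flow_defined (fast_slow_field f g \<epsilon>) (x0, y) (real ?n * Hh \<epsilon>)"
      by (rule M(3)) (use y(1) sub in blast)
    ultimately show ?case unfolding zeros using yC by (intro exI[of _ y] conjI)
  qed
  then obtain hhat where hhat: "\<forall>\<^sub>F \<epsilon> in at_right 0.
      flow_defined (fast_slow_field f g \<epsilon>) (x0, hhat \<epsilon>) (real ?n * Hh \<epsilon>) \<and>
      hhat \<epsilon> isolated_in {y. Fhat (\<phi> \<epsilon>) (H \<epsilon> / Hh \<epsilon>) (Hh \<epsilon>) m x0 y = y} \<and>
      norm (hhat \<epsilon> - h \<epsilon> x0) \<le> C' * \<epsilon> ^ ?n"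
    unfolding eventually_ex by blast
  have O1: "(\<lambda>\<epsilon>. norm (hhat \<epsilon> - h \<epsilon> x0)) \<in> O[at_right 0](\<lambda>\<epsilon>. \<epsilon> ^ ?n)"
  proof (rule landau_o.bigI[where c = "max C' 1"])
    show "\<forall>\<^sub>F \<epsilon> in at_right 0. norm (norm (hhat \<epsilon> - h \<epsilon> x0)) \<le> max C' 1 * norm (\<epsilon> ^ ?n)"
      using hhat small
    proof eventually_elim
      case (elim \<epsilon>)
      then have "norm (hhat \<epsilon> - h \<epsilon> x0) \<le> C' * \<epsilon> ^ ?n" by blast
      also have "\<dots> \<le> max C' 1 * \<epsilon> ^ ?n" using elim by (intro mult_right_mono) auto
      finally show ?case using elim by simp
    qed
  qed simp
  have tri: "norm (hhat \<epsilon> - hm \<epsilon>) \<le> norm (hhat \<epsilon> - h \<epsilon> x0) + norm (hm \<epsilon> - h \<epsilon> x0)" for \<epsilon>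
    using norm_triangle_ineq4[of "hhat \<epsilon> - h \<epsilon> x0" "hm \<epsilon> - h \<epsilon> x0"] by simp
  have "(\<lambda>\<epsilon>. norm (hhat \<epsilon> - hm \<epsilon>)) \<in> O[at_right 0](\<lambda>\<epsilon>. norm (hhat \<epsilon> - h \<epsilon> x0) + norm (hm \<epsilon> - h \<epsilon> x0))"
    by (intro landau_o.bigI[where c = 1] always_eventually allI)
      (simp_all add: tri)
  then have O2: "(\<lambda>\<epsilon>. norm (hhat \<epsilon> - hm \<epsilon>)) \<in> O[at_right 0](\<lambda>\<epsilon>. \<epsilon> ^ ?n)"
    using landau_o.big_trans sum_in_bigo(1)[OF O1 hm] by blast
  show ?thesis
  proof (intro exI[of _ hhat] conjI O1 O2)
    show "\<forall>\<^sub>F \<epsilon> in at_right 0. flow_defined (fast_slow_field f g \<epsilon>) (x0, hhat \<epsilon>) (real ?n * Hh \<epsilon>) \<and>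
        hhat \<epsilon> isolated_in {y. Fhat (\<phi> \<epsilon>) (H \<epsilon> / Hh \<epsilon>) (Hh \<epsilon>) m x0 y = y}"
      using hhat by eventually_elim blast
  qed
qed

end
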